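(* Let $\mathcal{H}=L^2(\mathcal{Z})$ and let $$X_i=\mu+\Delta_n\,g\!\left(\tfrac in\right)+\varepsilon_i,\qquad i=1,\ldots,n,$$ with $\mu,\Delta_n\in\mathcal{H}$. Assume that $g:[0,1]\to\mathbb{R}$ is non-constant, bounded, Riemann integrable and piecewise continuous (finitely many intervals of positive length on each of which it is continuous), with $g(0)=0$. Assume the errors satisfy the following two conditions. (A1) $\{\varepsilon_i\}_{i\in\mathbb{Z}}$ is a centered, strictly stationary sequence of $\mathcal{H}$-valued random variables with $\mathsf{E}\|\varepsilon_1\|^k<\infty$ for some $k>2$. With $C_r=\mathsf{E}[\varepsilon_0\otimes\varepsilon_r]$ one has $\sum_r\|C_r\|<\infty$, and $C_\varepsilon=\sum_rC_r\ne0$. Write $C_\varepsilon=\sum_{p\ge1}\lambda_{p,\varepsilon}v_{p,\varepsilon}\otimes v_{p,\varepsilon}$ with non-increasing eigenvalues and orthonormal basis $\{v_{p,\varepsilon}\}$. Moreover $\sum_{p\ge1}\sum_{h\in\mathbb{Z}}|\mathsf{Cov}(\langle\varepsilon_0,v_{p,\varepsilon}\rangle,\langle\varepsilon_h,v_{p,\varepsilon}\rangle)|<\infty$. (A2) $\{n^{-1/2}\sum_{i=1}^{\lfloor tn\rfloor}\varepsilon_i\}_{t\in[0,1]}$ converges weakly in $D^{\mathcal{H}}[0,1]$ to an $\mathcal{H}$-valued Brownian motion with covariance operator $C_\varepsilon$. Let $h:[-1,1]\to\mathbb{R}$ be non-constant with $h(x)=0$ for $x\le0$, of bounded total variation, and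 $\alpha$-Hölder continuous on $[0,1]$ for some $\alpha>0$. Assume $$\sup_{0\le t\le1}\Big|\int_0^1h(x-t)g(x)\,dx-\int_0^1g(x)\,dx\int_0^1h(x-t)\,dx\Big|>0,$$ and $\sqrt n\|\Delta_n\|\to\infty$. Define $$T_{n,\mathrm{FF}}(h)=\max_{1\le k<n}\Big\|\frac1{\sqrt n}\sum_{i=1}^nh\!\left(\tfrac{i-k}{n}\right)(X_i-\bar X_n)\Big\|,$$ $$T_{n,\mathrm{WF}}(h;\hat C_n)=\max_{1\le k<n}\Big\|(\hat C_n+\hat\lambda_1\mathrm{Id})^{-1/2}\frac1{\sqrt n}\sum_{i=1}^nh\!\left(\tfrac{i-k}{n}\right)(X_i-\bar X_n)\Big\|,$$ where $\hat C_n$ is a random bounded self-adjoint positive semidefinite operator computed from the data with largest eigenvalue $\hat\lambda_1$. Then $T_{n,\mathrm{FF}}(h)\to\infty$ in probability. If additionally $\|\hat C_n\|=o_P(n\|\Delta_n\|^2)$, then $T_{n,\mathrm{WF}}(h;\hat C_n)\to\infty$ in probability.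
   Context: $\mathcal{H}=L^2(\mathcal{Z})$ is the real separable Hilbert space of square-integrable functions on a domain $\mathcal{Z}$ with a $\sigma$-finite measure $\nu$, with inner product $\langle f,g\rangle=\int fg\,d\nu$ and norm $\|\cdot\|$. The tensor product is $(v\otimes w)(h)=\langle v,h\rangle w$. $\bar X_n=n^{-1}\sum_iX_i$, and $A^{-1/2}$ is the positive definite inverse square root of a positive definite operator $A$. *)

theory Defs
  imports "HOL-Probability.Probability"
begin

definition is_partition :: "real \<Rightarrow> real \<Rightarrow> nat \<Rightarrow> (nat \<Rightarrow> real) \<Rightarrow> bool" where
  "is_partition a b m p \<longleftrightarrow> p 0 = a \<and> p m = b \<and> (\<forall>j<m. p j < p (Suc j))"

definition riemann_integrable_on :: "(real \<Rightarrow> real) \<Rightarrow> real \<Rightarrow> real \<Rightarrow> bool" where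
  "riemann_integrable_on f a b \<longleftrightarrow> a < b \<and> bounded (f ` {a..b}) \<and>
     (\<forall>e>0. \<exists>m p. is_partition a b m p \<and>
        (\<Sum>j<m. ((SUP x\<in>{p j..p (Suc j)}. f x) - (INF x\<in>{p j..p (Suc j)}. f x)) * (p (Suc j) - p j)) < e)"

definition bounded_variation_on :: "(real \<Rightarrow> real) \<Rightarrow> real \<Rightarrow> real \<Rightarrow> bool" where
  "bounded_variation_on f a b \<longleftrightarrow>
     bdd_above {(\<Sum>j<m. \<bar>f (p (Suc j)) - f (p j)\<bar>) | m p. is_partition a b m p}"

definition piecewise_continuous_on :: "(real \<Rightarrow> real) \<Rightarrow> real \<Rightarrow> real \<Rightarrow> bool" where
  "piecewise_continuous_on f a b \<longleftrightarrow>
     (\<exists>\<I>. finite \<I> \<and> \<Union>\<I> = {a..b} \<and>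
        (\<forall>I\<in>\<I>. is_interval I \<and> (\<exists>c d. c < d \<and> {c<..<d} \<subseteq> I) \<and> continuous_on I f))"

definition holder_on :: "real \<Rightarrow> real set \<Rightarrow> (real \<Rightarrow> real) \<Rightarrow> bool" where
  "holder_on \<alpha> S f \<longleftrightarrow> (\<exists>L. \<forall>x\<in>S. \<forall>y\<in>S. \<bar>f x - f y\<bar> \<le> L * \<bar>x - y\<bar> powr \<alpha>)"

definition tensor :: "'h::real_inner \<Rightarrow> 'h \<Rightarrow> ('h \<Rightarrow> 'h)" where
  "tensor v w = (\<lambda>h. inner v h *\<^sub>R w)"

definition self_adjoint_op :: "('h::real_inner \<Rightarrow>\<^sub>L 'h) \<Rightarrow> bool" where
  "self_adjoint_op A \<longleftrightarrow> (\<forall>x y. inner (A x) y = inner x (A y))"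

definition psd_op :: "('h::real_inner \<Rightarrow>\<^sub>L 'h) \<Rightarrow> bool" where
  "psd_op A \<longleftrightarrow> self_adjoint_op A \<and> (\<forall>x. 0 \<le> inner (A x) x)"

definition pd_op :: "('h::real_inner \<Rightarrow>\<^sub>L 'h) \<Rightarrow> bool" where
  "pd_op A \<longleftrightarrow> self_adjoint_op A \<and> (\<forall>x. x \<noteq> 0 \<longrightarrow> 0 < inner (A x) x)"

definition inv_sqrt_op :: "('h::real_inner \<Rightarrow>\<^sub>L 'h) \<Rightarrow> ('h \<Rightarrow>\<^sub>L 'h)" where
  "inv_sqrt_op A = (THE S. pd_op S \<and> S o\<^sub>L S o\<^sub>L A = id_blinfun \<and> A o\<^sub>L S o\<^sub>L S = id_blinfun)"

definition largest_eigenvalue :: "('h::real_normed_vector \<Rightarrow>\<^sub>L 'h) \<Rightarrow> real \<Rightarrow> bool" where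
  "largest_eigenvalue A lam \<longleftrightarrow> (\<exists>x. x \<noteq> 0 \<and> A x = lam *\<^sub>R x) \<and>
     (\<forall>\<mu> x. x \<noteq> 0 \<and> A x = \<mu> *\<^sub>R x \<longrightarrow> \<mu> \<le> lam)"

text \<open>Orthonormal basis {v p} (p indexed from 0 here, p \<ge> 1 in the paper).\<close>
definition orthonormal_basis_seq :: "(nat \<Rightarrow> 'h::real_inner) \<Rightarrow> bool" where
  "orthonormal_basis_seq v \<longleftrightarrow> (\<forall>p q. inner (v p) (v q) = (if p = q then 1 else 0)) \<and>
     closure (span (range v)) = UNIV"

text \<open>Paths are functions real => 'h; only their restriction to [0,1] matters.\<close>
definition cadlag_on01 :: "(real \<Rightarrow> 'h::metric_space) \<Rightarrow> bool" where
  "cadlag_on01 x \<longleftrightarrow> (\<forall>t\<in>{0..<1}. continuous (at t within {t..1}) x) \<and>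
     (\<forall>t\<in>{0<..1}. \<exists>l. (x \<longlongrightarrow> l) (at t within {0..<t}))"

definition time_changes :: "(real \<Rightarrow> real) set" where
  "time_changes = {\<tau>. strict_mono_on {0..1} \<tau> \<and> continuous_on {0..1} \<tau> \<and> \<tau> ` {0..1} = {0..1}}"

definition skorokhod_dist :: "(real \<Rightarrow> 'h::metric_space) \<Rightarrow> (real \<Rightarrow> 'h) \<Rightarrow> real" where
  "skorokhod_dist x y = (INF \<tau>\<in>time_changes.
     max (SUP t\<in>{0..1}. \<bar>\<tau> t - t\<bar>) (SUP t\<in>{0..1}. dist (x t) (y (\<tau> t))))"

definition skorokhod_continuous :: "((real \<Rightarrow> 'h::metric_space) \<Rightarrow> real) \<Rightarrow> bool" where
  "skorokhod_continuous F \<longleftrightarrow> (\<forall>x. cadlag_on01 x \<longrightarrow> (\<forall>e>0. \<exists>d>0. \<forall>y. cadlag_on01 y \<longrightarrow>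
      skorokhod_dist x y < d \<longrightarrow> \<bar>F x - F y\<bar> < e))"

definition weak_conv_D :: "'a measure \<Rightarrow> (nat \<Rightarrow> 'a \<Rightarrow> real \<Rightarrow> 'h::metric_space) \<Rightarrow>
    'b measure \<Rightarrow> ('b \<Rightarrow> real \<Rightarrow> 'h) \<Rightarrow> bool" where
  "weak_conv_D M S N W \<longleftrightarrow>
     (\<forall>n. \<forall>\<omega>\<in>space M. cadlag_on01 (S n \<omega>)) \<and> (\<forall>\<omega>\<in>space N. cadlag_on01 (W \<omega>)) \<and>
     (\<forall>F. skorokhod_continuous F \<and> bounded (range F) \<and>
        (\<forall>n. (\<lambda>\<omega>. F (S n \<omega>)) \<in> borel_measurable M) \<and> (\<lambda>\<omega>. F (W \<omega>)) \<in> borel_measurable N \<longrightarrow>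
        (\<lambda>n. integral\<^sup>L M (\<lambda>\<omega>. F (S n \<omega>))) \<longlonglongrightarrow> integral\<^sup>L N (\<lambda>\<omega>. F (W \<omega>)))"

text \<open>H-valued Brownian motion on [0,1] with covariance operator C: a centered Gaussian
  process with continuous paths and E[<W s,x><W t,y>] = min s t * <C x, y>; Gaussianity and
  covariance are expressed through the characteristic functions of all finite linear
  functionals sum_j <W (t j), x j>.\<close>
definition brownian_motion :: "'b measure \<Rightarrow> ('b \<Rightarrow> real \<Rightarrow> 'h::{real_inner,banach}) \<Rightarrow>
    ('h \<Rightarrow>\<^sub>L 'h) \<Rightarrow> bool" where
  "brownian_motion N W C \<longleftrightarrow> prob_space N \<and>
     (\<forall>t\<in>{0..1}. (\<lambda>\<omega>. W \<omega> t) \<in> borel_measurable N) \<and>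
     (\<forall>\<omega>\<in>space N. continuous_on {0..1} (W \<omega>)) \<and>
     (\<forall>m (t::nat \<Rightarrow> real) (x::nat \<Rightarrow> 'h) (u::real). (\<forall>j<m. t j \<in> {0..1}) \<longrightarrow>
        (CLINT \<omega>|N. cis (u * (\<Sum>j<m. inner (W \<omega> (t j)) (x j)))) =
        complex_of_real (exp (- (u\<^sup>2 * (\<Sum>i<m. \<Sum>j<m. min (t i) (t j) * inner (C (x i)) (x j))) / 2)))"

definition strictly_stationary :: "'a measure \<Rightarrow> (int \<Rightarrow> 'a \<Rightarrow> 'h::topological_space) \<Rightarrow> bool" where
  "strictly_stationary M e \<longleftrightarrow> (\<forall>m::int.
     distr M (Pi\<^sub>M UNIV (\<lambda>_. borel)) (\<lambda>\<omega> i. e (i + m) \<omega>) =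
     distr M (Pi\<^sub>M UNIV (\<lambda>_. borel)) (\<lambda>\<omega> i. e i \<omega>))"

definition covariance :: "'a measure \<Rightarrow> ('a \<Rightarrow> real) \<Rightarrow> ('a \<Rightarrow> real) \<Rightarrow> real" where
  "covariance M X Y = integral\<^sup>L M (\<lambda>\<omega>. X \<omega> * Y \<omega>) - integral\<^sup>L M X * integral\<^sup>L M Y"

text \<open>Convergence to infinity in probability, P(T_n > K) --> 1 for every K, formulated with
  inner probability (no measurability of T_n needed).\<close>
definition tendsto_infinity_in_prob :: "'a measure \<Rightarrow> (nat \<Rightarrow> 'a \<Rightarrow> real) \<Rightarrow> bool" where
  "tendsto_infinity_in_prob M T \<longleftrightarrow> (\<forall>K. \<exists>B. (\<forall>n. B n \<in> sets M \<and> B n \<subseteq> {\<omega>\<in>space M. K < T n \<omega>}) \<and>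
       (\<lambda>n. measure M (B n)) \<longlonglongrightarrow> 1)"

text \<open>Y_n = o_P(a_n): P(|Y_n| \<le> e a_n) --> 1 for every e > 0 (inner probability).\<close>
definition small_o_P :: "'a measure \<Rightarrow> (nat \<Rightarrow> 'a \<Rightarrow> real) \<Rightarrow> (nat \<Rightarrow> real) \<Rightarrow> bool" where
  "small_o_P M Y a \<longleftrightarrow> (\<forall>e>0. \<exists>B. (\<forall>n. B n \<in> sets M \<and> B n \<subseteq> {\<omega>\<in>space M. \<bar>Y n \<omega>\<bar> \<le> e * a n}) \<and>
       (\<lambda>n. measure M (B n)) \<longlonglongrightarrow> 1)"

definition obs :: "'h::real_vector \<Rightarrow> (nat \<Rightarrow> 'h) \<Rightarrow> (real \<Rightarrow> real) \<Rightarrow> (int \<Rightarrow> 'a \<Rightarrow> 'h) \<Rightarrow>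
    nat \<Rightarrow> nat \<Rightarrow> 'a \<Rightarrow> 'h" where
  "obs \<mu> \<Delta> g e n i \<omega> = \<mu> + g (real i / real n) *\<^sub>R \<Delta> n + e (int i) \<omega>"

definition weighted_cusum :: "(real \<Rightarrow> real) \<Rightarrow> (nat \<Rightarrow> 'h::real_vector) \<Rightarrow> nat \<Rightarrow> nat \<Rightarrow> 'h" where
  "weighted_cusum h X n k = (1 / sqrt (real n)) *\<^sub>R
     (\<Sum>i=1..n. h ((real i - real k) / real n) *\<^sub>R (X i - (1 / real n) *\<^sub>R (\<Sum>j=1..n. X j)))"

definition T_FF :: "(real \<Rightarrow> real) \<Rightarrow> (nat \<Rightarrow> 'h::real_normed_vector) \<Rightarrow> nat \<Rightarrow> real" where
  "T_FF h X n = Max ((\<lambda>k. norm (weighted_cusum h X n k)) ` {1..<n})"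

definition T_WF :: "(real \<Rightarrow> real) \<Rightarrow> ('h::real_inner \<Rightarrow>\<^sub>L 'h) \<Rightarrow> real \<Rightarrow> (nat \<Rightarrow> 'h) \<Rightarrow> nat \<Rightarrow> real" where
  "T_WF h C lam X n = Max ((\<lambda>k. norm (inv_sqrt_op (C + lam *\<^sub>R id_blinfun) (weighted_cusum h X n k))) ` {1..<n})"

definition partial_sum_process :: "(int \<Rightarrow> 'a \<Rightarrow> 'h::real_normed_vector) \<Rightarrow> nat \<Rightarrow> 'a \<Rightarrow> real \<Rightarrow> 'h" where
  "partial_sum_process e n \<omega> t = (1 / sqrt (real n)) *\<^sub>R (\<Sum>i=1..nat \<lfloor>t * real n\<rfloor>. e (int i) \<omega>)"

end

theory Submission
  imports Defs
begin


text \<open>A single index suffices. Choose \<open>t\<close> where the functional in the hypothesis on \<open>h\<close> and \<open>g\<close> does not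
  vanish and let \<open>k / n \<rightarrow> t\<close>. The weighted CUSUM at \<open>k\<close> splits into \<open>\<surd>n d\<^sub>n \<Delta>\<^sub>n\<close>, where \<open>d\<^sub>n\<close> is a
  Riemann sum converging to a nonzero limit, and a noise term that is a weighted sum of the errors
  with bounded weights. The summable autocovariances along the eigenbasis bound the second moment of
  the noise uniformly in \<open>n\<close>, so by Markov's inequality the signal of order
  \<open>\<surd>n \<parallel>\<Delta>\<^sub>n\<parallel> \<rightarrow> \<infinity>\<close> dominates. For the weighted functional,
  \<open>\<parallel>y\<parallel>\<^sup>2 \<le> \<parallel>A\<parallel> \<parallel>A\<^sup>-\<^sup>1\<^sup>/\<^sup>2 y\<parallel>\<^sup>2\<close> and the shifted estimator has norm at most twice
  \<open>\<parallel>\<close>Chat\<open>\<parallel>\<close>, which is negligible against \<open>n \<parallel>\<Delta>\<^sub>n\<parallel>\<^sup>2\<close>.\<close>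

section \<open>Inverse square roots of coercive operators\<close>

lemma blinfun_compose_assoc: "(A o\<^sub>L B) o\<^sub>L C = A o\<^sub>L (B o\<^sub>L C)"
  by (simp add: blinfun_eqI)

lemma blinfun_compose_id [simp]: "id_blinfun o\<^sub>L A = A" "A o\<^sub>L id_blinfun = A"
  by (simp_all add: blinfun_eqI)

lemma self_adjoint_opD: "self_adjoint_op A \<Longrightarrow> inner (blinfun_apply A x) y = inner x (A y)"
  by (simp add: self_adjoint_op_def)

text \<open>Norm limits preserve self-adjointness and, by the next lemma, commutation relations.
  Banach's fixed-point theorem can therefore run inside the set of operators with these properties,
  and its fixed point inherits them.\<close>

lemma closed_self_adjoint_op: "closed {A::'h::real_inner \<Rightarrow>\<^sub>L 'h. self_adjoint_op A}"
  unfolding self_adjoint_op_def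
  by (intro closed_Collect_all closed_Collect_eq continuous_intros)

lemma closed_blinfun_commute:
  "closed {Y::'h::real_normed_vector \<Rightarrow>\<^sub>L 'h. S o\<^sub>L Y = Y o\<^sub>L S}"
  by (intro closed_Collect_eq bounded_linear.continuous_on[OF bounded_bilinear.bounded_linear_right[OF bounded_bilinear_blinfun_compose]]
     bounded_linear.continuous_on[OF bounded_bilinear.bounded_linear_left[OF bounded_bilinear_blinfun_compose]] continuous_intros)

text \<open>The Neumann series appears as the fixed point of \<open>Z = id + Y Z\<close>, a
  contraction with constant \<open>norm Y\<close>. The commutation clause is what uniqueness of the
  inverse square root later rests on.\<close>

lemma blinfun_one_minus_inverse:
  fixes Y :: "'h::{real_inner, banach} \<Rightarrow>\<^sub>L 'h"
  assumes Y: "norm Y < 1" "self_adjoint_op Y"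
  obtains Z where "self_adjoint_op Z"
    "(id_blinfun - Y) o\<^sub>L Z = id_blinfun" "Z o\<^sub>L (id_blinfun - Y) = id_blinfun"
    "\<And>S. S o\<^sub>L Y = Y o\<^sub>L S \<Longrightarrow> S o\<^sub>L Z = Z o\<^sub>L S"
proof -
  interpret c: bounded_bilinear "(o\<^sub>L) :: ('h \<Rightarrow>\<^sub>L 'h) \<Rightarrow> ('h \<Rightarrow>\<^sub>L 'h) \<Rightarrow> _"
    by (rule bounded_bilinear_blinfun_compose)
  define \<C> where "\<C> = {Z. \<forall>S. S o\<^sub>L Y = Y o\<^sub>L S \<longrightarrow> S o\<^sub>L Z = Z o\<^sub>L S}"
  have "closed \<C>"
    unfolding \<C>_def by (intro closed_Collect_all closed_Collect_imp closed_blinfun_commute) auto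
  have "\<exists>!Z\<in>\<C>. id_blinfun + (Y o\<^sub>L Z) = Z"
  proof (rule Banach_fix[OF complete_eq_closed[THEN iffD2, OF \<open>closed \<C>\<close>], where c = "norm Y"])
    show "\<C> \<noteq> {}" by (auto simp: \<C>_def intro!: exI[of _ 0])
    show "(\<lambda>Z. id_blinfun + (Y o\<^sub>L Z)) ` \<C> \<subseteq> \<C>"
    proof clarify
      fix Z assume "Z \<in> \<C>"
      show "id_blinfun + (Y o\<^sub>L Z) \<in> \<C>"
        unfolding \<C>_def
      proof clarify
        fix S assume S: "S o\<^sub>L Y = Y o\<^sub>L S"
        with \<open>Z \<in> \<C>\<close> have "S o\<^sub>L Z = Z o\<^sub>L S" by (auto simp: \<C>_def)
        with S show "S o\<^sub>L (id_blinfun + (Y o\<^sub>L Z)) = (id_blinfun + (Y o\<^sub>L Z)) o\<^sub>L S"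
          by (simp add: c.add_left c.add_right) (metis blinfun_compose_assoc)
      qed
    qed
    show "dist (id_blinfun + (Y o\<^sub>L Z)) (id_blinfun + (Y o\<^sub>L Z')) \<le> norm Y * dist Z Z'" for Z Z'
      using norm_blinfun_compose[of Y "Z - Z'"] by (simp add: dist_norm c.diff_right)
  qed (use Y in auto)
  then obtain Z where Z: "Z \<in> \<C>" "id_blinfun + (Y o\<^sub>L Z) = Z" by blast
  have comm: "S o\<^sub>L Z = Z o\<^sub>L S" if "S o\<^sub>L Y = Y o\<^sub>L S" for S
    using Z that by (auto simp: \<C>_def)
  have r: "(id_blinfun - Y) o\<^sub>L Z = id_blinfun"
    using Z(2) by (simp add: c.diff_left) (metis add_diff_cancel_right')
  \<comment> \<open>\<open>Y\<close> commutes with itself, hence with \<open>Z\<close>, so the right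
    inverse is also a left inverse.\<close>
  have l: "Z o\<^sub>L (id_blinfun - Y) = id_blinfun"
    using r comm[of Y] by (simp add: c.diff_left c.diff_right)
  have ap: "x = Z x - Y (Z x)" for x
    using r by (metis (no_types) blinfun.diff_left blinfun_apply_blinfun_compose blinfun_apply_id_blinfun id_apply)
  have "inner (Z x) y = inner x (Z y)" for x y
  proof -
    have "inner (Z x) y = inner (Z x) (Z y - Y (Z y))" by (metis ap)
    also have "\<dots> = inner (Z x - Y (Z x)) (Z y)"
      by (simp add: inner_diff_left inner_diff_right self_adjoint_opD[OF Y(2)])
    also have "\<dots> = inner x (Z y)" by (metis ap)
    finally show ?thesis .
  qed
  then have "self_adjoint_op Z" by (simp add: self_adjoint_op_def)
  then show ?thesis using that r l comm by blast
qed

text \<open>The substitution \<open>R = id - Y\<close> turns \<open>R\<^sup>2 = id - T\<close> into the fixed-point equation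
  \<open>Y = (T + Y\<^sup>2) / 2\<close>, a contraction of the ball of radius \<open>1 - sqrt (1 - norm T)\<close>.\<close>

lemma blinfun_one_minus_sqrt:
  fixes T :: "'h::{real_inner, banach} \<Rightarrow>\<^sub>L 'h"
  assumes T: "norm T < 1" "self_adjoint_op T"
  obtains Y where "norm Y < 1" "self_adjoint_op Y"
    "(id_blinfun - Y) o\<^sub>L (id_blinfun - Y) = id_blinfun - T"
    "\<And>S. S o\<^sub>L T = T o\<^sub>L S \<Longrightarrow> S o\<^sub>L Y = Y o\<^sub>L S"
proof -
  interpret c: bounded_bilinear "(o\<^sub>L) :: ('h \<Rightarrow>\<^sub>L 'h) \<Rightarrow> ('h \<Rightarrow>\<^sub>L 'h) \<Rightarrow> _"
    by (rule bounded_bilinear_blinfun_compose)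
  \<comment> \<open>\<open>r\<close> is the smaller root of \<open>norm T + r * r = 2 * r\<close>:
    with it \<open>f\<close> maps the ball of radius \<open>r\<close> into itself, and the same
    number serves as contraction constant.\<close>
  define r where "r = 1 - sqrt (1 - norm T)"
  have r: "0 \<le> r" "r < 1" "norm T + r * r = 2 * r"
    using T(1) by (auto simp: r_def algebra_simps)
  define f where "f Y = (1/2) *\<^sub>R (T + (Y o\<^sub>L Y))" for Y
  define \<C> where "\<C> = cball 0 r \<inter> {Y. self_adjoint_op Y} \<inter>
    {Y. \<forall>S. S o\<^sub>L T = T o\<^sub>L S \<longrightarrow> S o\<^sub>L Y = Y o\<^sub>L S}"
  have "closed \<C>"
    unfolding \<C>_def
    by (intro closed_Int closed_self_adjoint_op closed_Collect_all closed_Collect_imp closed_blinfun_commute) auto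
  have "\<exists>!Y\<in>\<C>. f Y = Y"
  proof (rule Banach_fix[OF complete_eq_closed[THEN iffD2, OF \<open>closed \<C>\<close>], where c = r])
    have "0 \<in> \<C>" using r by (auto simp: \<C>_def self_adjoint_op_def)
    then show "\<C> \<noteq> {}" by blast
    show "f ` \<C> \<subseteq> \<C>"
    proof clarify
      fix Y assume "Y \<in> \<C>"
      then have Y: "norm Y \<le> r" "self_adjoint_op Y" "\<And>S. S o\<^sub>L T = T o\<^sub>L S \<Longrightarrow> S o\<^sub>L Y = Y o\<^sub>L S"
        unfolding \<C>_def by auto
      have "norm (f Y) \<le> (norm T + norm Y * norm Y) / 2"
        using norm_triangle_ineq[of T "Y o\<^sub>L Y"] norm_blinfun_compose[of Y Y] by (simp add: f_def)
      also have "\<dots> \<le> (norm T + r * r) / 2"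
        using Y(1) r by (intro divide_right_mono add_mono mult_mono) auto
      finally have "norm (f Y) \<le> r" using r by simp
      moreover have "self_adjoint_op (f Y)"
        using Y(2) T(2) by (auto simp: self_adjoint_op_def f_def blinfun.scaleR_left blinfun.add_left
            inner_add_left inner_add_right)
      moreover have "S o\<^sub>L f Y = f Y o\<^sub>L S" if S: "S o\<^sub>L T = T o\<^sub>L S" for S
      proof -
        have "S o\<^sub>L Y = Y o\<^sub>L S" using S Y(3) by blast
        then have "S o\<^sub>L (Y o\<^sub>L Y) = (Y o\<^sub>L Y) o\<^sub>L S" by (metis blinfun_compose_assoc)
        with S show ?thesis by (simp add: f_def c.add_left c.add_right c.scaleR_left c.scaleR_right)
      qed
      ultimately show "f Y \<in> \<C>" unfolding \<C>_def by auto
    qed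
    fix Y Z assume "Y \<in> \<C>" "Z \<in> \<C>"
    then have YZ: "norm Y \<le> r" "norm Z \<le> r" unfolding \<C>_def by auto
    \<comment> \<open>Difference of squares for operators that need not commute: Y^2 - Z^2 = Y (Y -
      Z) + (Y - Z) Z.\<close>
    have "f Y - f Z = (1/2) *\<^sub>R ((Y o\<^sub>L (Y - Z)) + ((Y - Z) o\<^sub>L Z))"
      by (simp add: f_def c.diff_left c.diff_right algebra_simps)
    then have "norm (f Y - f Z) \<le> (norm Y * norm (Y - Z) + norm (Y - Z) * norm Z) / 2"
      using norm_triangle_ineq[of "Y o\<^sub>L (Y - Z)" "(Y - Z) o\<^sub>L Z"]
        norm_blinfun_compose[of Y "Y - Z"] norm_blinfun_compose[of "Y - Z" Z] by simp
    also have "\<dots> \<le> (r * norm (Y - Z) + norm (Y - Z) * r) / 2"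
      using YZ r by (intro divide_right_mono add_mono mult_mono) auto
    finally show "dist (f Y) (f Z) \<le> r * dist Y Z" by (simp add: dist_norm mult.commute)
  qed (use r in auto)
  then obtain Y where Y: "Y \<in> \<C>" "f Y = Y" by blast
  have "2 *\<^sub>R Y = T + (Y o\<^sub>L Y)" by (subst Y(2)[symmetric]) (simp add: f_def)
  then have "(id_blinfun - Y) o\<^sub>L (id_blinfun - Y) = id_blinfun - T"
    by (simp add: c.diff_left c.diff_right algebra_simps scaleR_2)
  moreover have "norm Y < 1" "self_adjoint_op Y" "\<And>S. S o\<^sub>L T = T o\<^sub>L S \<Longrightarrow> S o\<^sub>L Y = Y o\<^sub>L S"
    using Y(1) r unfolding \<C>_def by auto
  ultimately show ?thesis using that by blast
qed

text \<open>The predicate under the \<open>THE\<close> of \<open>inv_sqrt_op\<close>, isolated so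
  that existence and uniqueness can be treated separately.\<close>

definition is_inv_sqrt :: "('h::real_inner \<Rightarrow>\<^sub>L 'h) \<Rightarrow> ('h \<Rightarrow>\<^sub>L 'h) \<Rightarrow> bool" where
  "is_inv_sqrt A S \<longleftrightarrow> pd_op S \<and> S o\<^sub>L S o\<^sub>L A = id_blinfun \<and> A o\<^sub>L S o\<^sub>L S = id_blinfun"

text \<open>Coercivity and boundedness allow a scaling with \<open>id - A / c\<close> of norm below
  1. Then \<open>A / c\<close> has a square root \<open>id - Y\<close> with
  \<open>norm Y < 1\<close>, the Neumann inverse \<open>Z\<close> of that root exists, and
  \<open>Z / sqrt c\<close> is the required operator.\<close>

lemma inv_sqrt_op_exists:
  fixes A :: "'h::{real_inner, banach} \<Rightarrow>\<^sub>L 'h"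
  assumes A: "self_adjoint_op A" and l: "0 < l" and coercive: "\<And>x. l * (norm x)\<^sup>2 \<le> inner (A x) x"
  obtains S where "is_inv_sqrt A S" "\<And>B. B o\<^sub>L A = A o\<^sub>L B \<Longrightarrow> B o\<^sub>L S = S o\<^sub>L B"
proof (cases "\<exists>x::'h. x \<noteq> 0")
  case False
  then have "B = B'" for B B' :: "'h \<Rightarrow>\<^sub>L 'h" by (metis blinfun_eqI)
  with False show ?thesis using that[of 0] by (auto simp: is_inv_sqrt_def pd_op_def self_adjoint_op_def)
next
  case True
  interpret c: bounded_bilinear "(o\<^sub>L) :: ('h \<Rightarrow>\<^sub>L 'h) \<Rightarrow> ('h \<Rightarrow>\<^sub>L 'h) \<Rightarrow> _"
    by (rule bounded_bilinear_blinfun_compose)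
  obtain x0 :: 'h where x0: "x0 \<noteq> 0" using True by blast
  have "l * (norm x0)\<^sup>2 \<le> norm A * norm x0 * norm x0"
    using coercive[of x0] norm_cauchy_schwarz[of "A x0" x0] norm_blinfun[of A x0]
    by (smt (verit) mult_right_mono norm_ge_zero)
  then have lA: "l \<le> norm A" using x0 by (simp add: power2_eq_square mult.assoc)
  define a where "a = norm A"
  have a: "0 < a" "l \<le> a" using lA l by (auto simp: a_def)
  \<comment> \<open>This \<open>c\<close> minimises the factor 1 - 2 l / c + (a / c)^2 that bounds
    \<open>(norm (T x))^2 / (norm x)^2\<close>; the minimum is \<open>q\<close>.\<close>
  define c where "c = a\<^sup>2 / l"
  have c: "0 < c" using a l by (simp add: c_def)
  define T where "T = id_blinfun - (1/c) *\<^sub>R A"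
  have Tsa: "self_adjoint_op T"
    using A by (auto simp: T_def self_adjoint_op_def blinfun.diff_left blinfun.scaleR_left inner_diff_left inner_diff_right)
  define q where "q = 1 - (l/a)\<^sup>2"
  have q: "0 \<le> q" "q < 1" using a l by (auto simp: q_def divide_le_eq_1 power_le_one)
  have "(norm (T x))\<^sup>2 \<le> q * (norm x)\<^sup>2" for x
  proof -
    have "(norm (T x))\<^sup>2 = (norm x)\<^sup>2 - 2 / c * inner (A x) x + (1/c)\<^sup>2 * (norm (A x))\<^sup>2"
      unfolding power2_norm_eq_inner
      by (simp add: T_def blinfun.diff_left blinfun.scaleR_left inner_diff_left
          inner_diff_right inner_commute power2_eq_square)
    also have "\<dots> \<le> (norm x)\<^sup>2 - 2 / c * (l * (norm x)\<^sup>2) + (1/c)\<^sup>2 * (a * norm x)\<^sup>2"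
      using coercive[of x] norm_blinfun[of A x] c
      by (intro add_mono diff_mono mult_left_mono power_mono) (auto simp: a_def)
    also have "\<dots> = q * (norm x)\<^sup>2"
      using a l by (simp add: q_def c_def field_simps power2_eq_square)
    finally show ?thesis .
  qed
  then have "norm (T x) \<le> sqrt q * norm x" for x
    by (metis norm_ge_zero real_le_rsqrt real_sqrt_abs abs_norm_cancel real_sqrt_mult)
  then have "norm T \<le> sqrt q" using q by (intro norm_blinfun_bound) auto
  with q have "norm T < 1" by (smt (verit) real_sqrt_lt_1_iff)
  then obtain Y where Y: "norm Y < 1" "self_adjoint_op Y"
    "(id_blinfun - Y) o\<^sub>L (id_blinfun - Y) = id_blinfun - T"
    "\<And>S. S o\<^sub>L T = T o\<^sub>L S \<Longrightarrow> S o\<^sub>L Y = Y o\<^sub>L S"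
    using blinfun_one_minus_sqrt Tsa by blast
  obtain Z where Z: "self_adjoint_op Z"
    "(id_blinfun - Y) o\<^sub>L Z = id_blinfun" "Z o\<^sub>L (id_blinfun - Y) = id_blinfun"
    "\<And>S. S o\<^sub>L Y = Y o\<^sub>L S \<Longrightarrow> S o\<^sub>L Z = Z o\<^sub>L S"
    using blinfun_one_minus_inverse Y by blast
  have RR: "(id_blinfun - Y) o\<^sub>L (id_blinfun - Y) = (1/c) *\<^sub>R A"
    using Y(3) by (simp add: T_def)
  define S where "S = (1 / sqrt c) *\<^sub>R Z"
  have SS: "S o\<^sub>L S = (1 / c) *\<^sub>R (Z o\<^sub>L Z)"
    using c by (simp add: S_def c.scaleR_left c.scaleR_right)
  have "S o\<^sub>L S o\<^sub>L A = (Z o\<^sub>L Z) o\<^sub>L ((1/c) *\<^sub>R A)"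
    by (simp add: SS c.scaleR_left c.scaleR_right)
  also have "\<dots> = Z o\<^sub>L (Z o\<^sub>L (id_blinfun - Y)) o\<^sub>L (id_blinfun - Y)"
    by (simp only: RR[symmetric] blinfun_compose_assoc)
  also have "\<dots> = id_blinfun" by (simp add: Z)
  finally have 1: "S o\<^sub>L S o\<^sub>L A = id_blinfun" .
  have "A o\<^sub>L S o\<^sub>L S = ((1/c) *\<^sub>R A) o\<^sub>L (Z o\<^sub>L Z)"
    by (simp add: SS c.scaleR_left c.scaleR_right blinfun_compose_assoc)
  also have "\<dots> = (id_blinfun - Y) o\<^sub>L (((id_blinfun - Y) o\<^sub>L Z) o\<^sub>L Z)"
    by (simp only: RR[symmetric] blinfun_compose_assoc)
  also have "\<dots> = id_blinfun" by (simp add: Z)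
  finally have 2: "A o\<^sub>L S o\<^sub>L S = id_blinfun" .
  have ap: "Z x - Y (Z x) = x" for x
    using Z(2) by (metis (no_types) blinfun.diff_left blinfun_apply_blinfun_compose blinfun_apply_id_blinfun id_apply)
  \<comment> \<open>With z = Z x and x = z - Y z, the inner product is at least (1 - norm Y) (norm
    z)^2.\<close>
  have "0 < inner (Z x) x" if "x \<noteq> 0" for x
  proof -
    have "Z x \<noteq> 0" using ap[of x] that by auto
    have "inner (Z x) x = inner (Z x) (Z x) - inner (Z x) (Y (Z x))"
      by (metis ap inner_diff_right)
    moreover have "inner (Z x) (Y (Z x)) \<le> norm (Z x) * (norm Y * norm (Z x))"
      by (meson norm_cauchy_schwarz norm_blinfun mult_left_mono norm_ge_zero order_trans)
    moreover have "norm Y * (norm (Z x))\<^sup>2 < 1 * (norm (Z x))\<^sup>2"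
      using Y(1) \<open>Z x \<noteq> 0\<close> by (intro mult_strict_right_mono) auto
    ultimately show ?thesis by (simp add: power2_norm_eq_inner[symmetric] power2_eq_square algebra_simps)
  qed
  then have "pd_op S"
    using Z(1) c by (auto simp: pd_op_def S_def self_adjoint_op_def blinfun.scaleR_left)
  moreover have "B o\<^sub>L S = S o\<^sub>L B" if B: "B o\<^sub>L A = A o\<^sub>L B" for B
  proof -
    have "B o\<^sub>L T = T o\<^sub>L B" using B by (simp add: T_def c.diff_left c.diff_right c.scaleR_left c.scaleR_right)
    then have "B o\<^sub>L Z = Z o\<^sub>L B" using Y(4) Z(4) by blast
    then show ?thesis by (simp add: S_def c.scaleR_left c.scaleR_right)
  qed
  moreover have "is_inv_sqrt A S" using \<open>pd_op S\<close> 1 2 by (simp add: is_inv_sqrt_def)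
  ultimately show ?thesis using that by blast
qed

text \<open>Insert \<open>A S S = id\<close> on the left and cancel \<open>S S A = id\<close> on the
  right. Hence every candidate lies in the commutant of \<open>A\<close>.\<close>

lemma is_inv_sqrt_commute:
  assumes "is_inv_sqrt A S"
  shows "S o\<^sub>L A = A o\<^sub>L S"
proof -
  have "S o\<^sub>L A = (A o\<^sub>L S o\<^sub>L S) o\<^sub>L (S o\<^sub>L A)" using assms by (simp add: is_inv_sqrt_def)
  also have "\<dots> = (A o\<^sub>L S) o\<^sub>L (S o\<^sub>L S o\<^sub>L A)" by (simp only: blinfun_compose_assoc)
  also have "\<dots> = A o\<^sub>L S" using assms by (simp add: is_inv_sqrt_def)
  finally show ?thesis .
qed

text \<open>Both squares equal the inverse of \<open>A\<close>, so commutation gives (S' + S)(S' -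
  S) = 0. The sum of two positive definite operators is injective, which forces the difference to
  vanish.\<close>

lemma is_inv_sqrt_unique:
  assumes S: "is_inv_sqrt A S" and S': "is_inv_sqrt A S'" and comm: "S' o\<^sub>L S = S o\<^sub>L S'"
  shows "S' = S"
proof (rule blinfun_eqI)
  fix x
  have sq: "S' o\<^sub>L S' = S o\<^sub>L S"
    using S S' unfolding is_inv_sqrt_def
    by (metis blinfun_compose_assoc blinfun_compose_id)
  have c': "S' (S y) = S (S' y)" "S' (S' y) = S (S y)" for y
    using comm sq by (metis blinfun_apply_blinfun_compose)+
  define y where "y = S' x - S x"
  have "S' y + S y = 0" by (simp add: y_def blinfun.diff_right c')
  then have "inner (S' y) y + inner (S y) y = 0" by (metis inner_add_left inner_zero_left)
  then have "y = 0" using S S' by (smt (verit) is_inv_sqrt_def pd_op_def)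
  then show "S' x = S x" by (simp add: y_def)
qed

text \<open>Any candidate commutes with \<open>A\<close>, hence with the root constructed above,
  hence equals it; so the definite description denotes.\<close>

lemma inv_sqrt_op_is_inv_sqrt:
  fixes A :: "'h::{real_inner, banach} \<Rightarrow>\<^sub>L 'h"
  assumes "self_adjoint_op A" "0 < l" "\<And>x. l * (norm x)\<^sup>2 \<le> inner (A x) x"
  shows "is_inv_sqrt A (inv_sqrt_op A)"
proof -
  obtain S where S: "is_inv_sqrt A S" "\<And>B. B o\<^sub>L A = A o\<^sub>L B \<Longrightarrow> B o\<^sub>L S = S o\<^sub>L B"
    using inv_sqrt_op_exists[OF assms] by blast
  have "is_inv_sqrt A S' \<Longrightarrow> S' = S" for S'
    using S is_inv_sqrt_commute is_inv_sqrt_unique by blast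
  then have "is_inv_sqrt A (THE S. is_inv_sqrt A S)" using S(1) by (metis theI)
  then show ?thesis by (simp add: inv_sqrt_op_def is_inv_sqrt_def)
qed

text \<open>\<open>A o\<^sub>L S\<close> is the positive square root of \<open>A\<close> and inverts \<open>S\<close>.\<close>

lemma norm_le_norm_inv_sqrt:
  assumes "self_adjoint_op A" and S: "is_inv_sqrt A S"
  shows "norm y \<le> sqrt (norm A) * norm (S y)"
proof -
  have comm: "S (A x) = A (S x)" and inv: "A (S (S x)) = x" for x
    using is_inv_sqrt_commute[OF S] S unfolding is_inv_sqrt_def
    by (metis blinfun_apply_blinfun_compose blinfun_apply_id_blinfun id_apply)+
  have sa: "inner (S x) y = inner x (S y)" "inner (A x) y = inner x (A y)" for x y
    using S assms(1) by (auto simp: is_inv_sqrt_def pd_op_def self_adjoint_op_def)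
  define z where "z = S y"
  have "(norm y)\<^sup>2 = inner (A (S z)) (A (S z))" by (simp add: z_def inv power2_norm_eq_inner)
  also have "\<dots> = inner z (A z)" by (simp add: sa comm inv)
  also have "\<dots> \<le> norm z * (norm A * norm z)"
    by (meson norm_cauchy_schwarz norm_blinfun mult_left_mono norm_ge_zero order_trans)
  also have "\<dots> = (sqrt (norm A) * norm z)\<^sup>2" by (simp add: power_mult_distrib power2_eq_square)
  finally show ?thesis by (simp add: z_def power2_le_iff_abs_le)
qed

section \<open>Second moments of weighted sums of a stationary sequence\<close>

text \<open>Let \<open>w\<close> be the orthogonal projection of \<open>y\<close> onto the first
  \<open>P\<close> vectors. Pythagoras splits the squared norm of \<open>y\<close> at
  \<open>w\<close>, and the distance from \<open>y\<close> to \<open>w\<close> is at most that to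
  any other point \<open>z\<close> of the span.\<close>

lemma norm_le_orthonormal_sum:
  fixes v :: "nat \<Rightarrow> 'h::real_inner"
  assumes v: "\<And>p q. inner (v p) (v q) = (if p = q then 1 else 0)" and z: "z \<in> span (v ` {..<P})"
  shows "(norm y)\<^sup>2 \<le> (\<Sum>p<P. (inner y (v p))\<^sup>2) + (norm (y - z))\<^sup>2"
proof -
  define w where "w = (\<Sum>p<P. inner y (v p) *\<^sub>R v p)"
  have vw: "inner (v p) (y - w) = 0" if "p < P" for p
    using that by (simp add: w_def inner_diff_right inner_sum_right v inner_commute if_distrib sum.delta cong: if_cong)
  have "w \<in> span (v ` {..<P})"
    unfolding w_def by (intro span_sum span_scale span_base) auto
  then have "w - z \<in> span (v ` {..<P})" using z by (intro span_diff)
  then have "orthogonal (y - w) (w - z)"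
    by (rule orthogonal_to_span) (auto simp: orthogonal_def vw inner_commute)
  then have "(norm (y - w + (w - z)))\<^sup>2 = (norm (y - w))\<^sup>2 + (norm (w - z))\<^sup>2"
    by (rule norm_add_Pythagorean)
  moreover have "(norm y)\<^sup>2 = (norm (y - w))\<^sup>2 + (\<Sum>p<P. (inner y (v p))\<^sup>2)"
  proof -
    have "orthogonal (y - w) w"
      unfolding orthogonal_def by (subst (2) w_def) (simp add: inner_sum_right inner_commute[of "y - w"] vw)
    then have "(norm (y - w + w))\<^sup>2 = (norm (y - w))\<^sup>2 + (norm w)\<^sup>2"
      by (rule norm_add_Pythagorean)
    moreover have "inner w w = (\<Sum>p<P. (inner y (v p))\<^sup>2)"
      by (simp add: w_def inner_sum_right inner_sum_left v if_distrib sum.delta power2_eq_square cong: if_cong)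
    ultimately show ?thesis by (simp add: power2_norm_eq_inner)
  qed
  ultimately show ?thesis by simp
qed

text \<open>The half of Parseval's identity that uses completeness. Values in \<open>ennreal\<close>
  make the series meaningful without a summability proof and fit Tonelli's theorem later.\<close>

lemma norm_le_orthonormal_basis_suminf:
  assumes "orthonormal_basis_seq v"
  shows "ennreal ((norm y)\<^sup>2) \<le> (\<Sum>p. ennreal ((inner y (v p))\<^sup>2))"
proof (rule ennreal_le_epsilon)
  fix e :: real assume "0 < e"
  have "y \<in> closure (span (range v))" using assms by (simp add: orthonormal_basis_seq_def)
  then obtain z where z: "z \<in> span (range v)" "dist z y < sqrt e"
    using \<open>0 < e\<close> by (metis closure_approachable real_sqrt_gt_zero)
  \<comment> \<open>An element of the span involves finitely many basis vectors, so it already lies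
    in the span of the first \<open>P\<close>.\<close>
  from z(1) obtain T where T: "finite T" "T \<subseteq> range v" "z \<in> span T"
    by (auto simp: span_explicit intro: span_sum span_scale span_base)
  obtain I where I: "finite I" "T = v ` I" using T by (meson finite_subset_image)
  obtain P where "I \<subseteq> {..<P}" using I(1) finite_nat_bounded by blast
  then have "z \<in> span (v ` {..<P})" using T(3) I(2) by (meson image_mono span_mono subsetD)
  then have "(norm y)\<^sup>2 \<le> (\<Sum>p<P. (inner y (v p))\<^sup>2) + (norm (y - z))\<^sup>2"
    using assms by (intro norm_le_orthonormal_sum) (auto simp: orthonormal_basis_seq_def)
  also have "(norm (y - z))\<^sup>2 \<le> (sqrt e)\<^sup>2"
    using z(2) by (intro power_mono) (auto simp: dist_norm norm_minus_commute)
  finally have "ennreal ((norm y)\<^sup>2) \<le> ennreal ((\<Sum>p<P. (inner y (v p))\<^sup>2) + e)"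
    using \<open>0 < e\<close> by (simp add: ennreal_leI)
  also have "\<dots> = (\<Sum>p<P. ennreal ((inner y (v p))\<^sup>2)) + ennreal e"
    using \<open>0 < e\<close> by (simp add: ennreal_plus sum_nonneg)
  also have "\<dots> \<le> (\<Sum>p. ennreal ((inner y (v p))\<^sup>2)) + ennreal e"
    by (intro add_right_mono sum_le_suminf) auto
  finally show "ennreal ((norm y)\<^sup>2) \<le> (\<Sum>p. ennreal ((inner y (v p))\<^sup>2)) + ennreal e" .
qed

lemma strictly_stationary_shift:
  assumes st: "strictly_stationary M e" and e: "\<And>i. e i \<in> borel_measurable M"
    and F: "F \<in> borel_measurable (Pi\<^sub>M UNIV (\<lambda>_::int. borel))"
  shows "distr M borel (\<lambda>\<omega>. F (\<lambda>i. e (i + m) \<omega>)) = distr M borel (\<lambda>\<omega>. F (\<lambda>i. e i \<omega>))"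
proof -
  have m: "(\<lambda>\<omega> i. e (i + m) \<omega>) \<in> M \<rightarrow>\<^sub>M Pi\<^sub>M UNIV (\<lambda>_. borel)" for m
    by (rule measurable_PiM_single') (use e in auto)
  have "distr (distr M (Pi\<^sub>M UNIV (\<lambda>_. borel)) (\<lambda>\<omega> i. e (i + m) \<omega>)) borel F
      = distr (distr M (Pi\<^sub>M UNIV (\<lambda>_. borel)) (\<lambda>\<omega> i. e i \<omega>)) borel F"
    using st by (simp add: strictly_stationary_def)
  then show ?thesis
    using m[of m] m[of 0] F by (simp add: distr_distr comp_def)
qed

text \<open>The functional reads coordinates 0 and \<open>j - i\<close>; shifting the sequence by
  \<open>i\<close> leaves its law unchanged, so joint moments depend on the lag only.\<close>

lemma strictly_stationary_pair:
  fixes e :: "int \<Rightarrow> 'a \<Rightarrow> 'h::{second_countable_topology, topological_space}" and f :: "'h \<Rightarrow> 'h \<Rightarrow> real"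
  assumes st: "strictly_stationary M e" and e: "\<And>i. e i \<in> borel_measurable M"
    and f: "case_prod f \<in> borel_measurable (borel \<Otimes>\<^sub>M borel)"
  shows "integral\<^sup>L M (\<lambda>\<omega>. f (e i \<omega>) (e j \<omega>)) = integral\<^sup>L M (\<lambda>\<omega>. f (e 0 \<omega>) (e (j - i) \<omega>))"
    "integrable M (\<lambda>\<omega>. f (e i \<omega>) (e j \<omega>)) \<longleftrightarrow> integrable M (\<lambda>\<omega>. f (e 0 \<omega>) (e (j - i) \<omega>))"
proof -
  define F where "F x = f (x 0) (x (j - i))" for x :: "int \<Rightarrow> 'h"
  have Fm: "F \<in> borel_measurable (Pi\<^sub>M UNIV (\<lambda>_::int. borel))"
    using measurable_compose[OF measurable_Pair[OF measurable_component_singleton[of 0 UNIV "\<lambda>_. borel"]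
        measurable_component_singleton[of "j - i" UNIV "\<lambda>_. borel"]] f]
    by (simp add: F_def[abs_def])
  have m: "(\<lambda>\<omega>. f (e i \<omega>) (e j \<omega>)) \<in> borel_measurable M" for i j
    using measurable_compose[OF measurable_Pair[OF e e] f] by simp
  have d: "distr M borel (\<lambda>\<omega>. f (e i \<omega>) (e j \<omega>)) = distr M borel (\<lambda>\<omega>. f (e 0 \<omega>) (e (j - i) \<omega>))"
    using strictly_stationary_shift[OF st e Fm, of i] by (simp add: F_def)
  show "integral\<^sup>L M (\<lambda>\<omega>. f (e i \<omega>) (e j \<omega>)) = integral\<^sup>L M (\<lambda>\<omega>. f (e 0 \<omega>) (e (j - i) \<omega>))"
    using arg_cong[OF d, of "\<lambda>D. integral\<^sup>L D (\<lambda>x. x)"] m by (simp add: integral_distr)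
  show "integrable M (\<lambda>\<omega>. f (e i \<omega>) (e j \<omega>)) \<longleftrightarrow> integrable M (\<lambda>\<omega>. f (e 0 \<omega>) (e (j - i) \<omega>))"
    using arg_cong[OF d, of "\<lambda>D. integrable D (\<lambda>x. x)"] m by (simp add: integrable_distr_eq)
qed

lemma (in prob_space) integrable_norm_sq_if_powr:
  fixes X :: "'a \<Rightarrow> 'h::real_normed_vector"
  assumes X: "X \<in> borel_measurable M" and k: "2 < k" "integrable M (\<lambda>\<omega>. norm (X \<omega>) powr k)"
  shows "integrable M (\<lambda>\<omega>. (norm (X \<omega>))\<^sup>2)"
proof (rule Bochner_Integration.integrable_bound)
  show "integrable M (\<lambda>\<omega>. 1 + norm (X \<omega>) powr k)" using k by simp
  have "t\<^sup>2 \<le> 1 + t powr k" if "0 \<le> t" for t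
  proof (cases "t \<le> 1")
    case True
    then have "t\<^sup>2 \<le> 1" using that by (simp add: power_le_one)
    then show ?thesis by (smt (verit) powr_ge_zero)
  next
    case False
    then have "t powr 2 \<le> t powr k" using k by (intro powr_mono) auto
    then show ?thesis using False by (simp add: powr_numeral)
  qed
  then show "AE \<omega> in M. norm ((norm (X \<omega>))\<^sup>2) \<le> norm (1 + norm (X \<omega>) powr k)"
    by (intro AE_I2) (auto simp: abs_of_nonneg)
qed (use X in measurable)

lemma (in prob_space) integrable_if_norm_sq:
  fixes X :: "'a \<Rightarrow> 'h::{banach, second_countable_topology}"
  assumes X: "X \<in> borel_measurable M" and "integrable M (\<lambda>\<omega>. (norm (X \<omega>))\<^sup>2)"
  shows "integrable M X"
proof (rule Bochner_Integration.integrable_bound)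
  show "integrable M (\<lambda>\<omega>. 1 + (norm (X \<omega>))\<^sup>2)" using assms by simp
  have "t \<le> 1 + t\<^sup>2" for t :: real
    using zero_le_power2[of "t - 1"] zero_le_power2[of t] unfolding power2_diff one_power2 by linarith
  then show "AE \<omega> in M. norm (X \<omega>) \<le> norm (1 + (norm (X \<omega>))\<^sup>2)"
    by (intro AE_I2) (auto simp: abs_of_nonneg)
qed (rule X)

text \<open>Expanding \<open>\<parallel>\<Sum>i. a i *\<^sub>R e i\<parallel>\<^sup>2\<close> along the basis leaves a sum of autocovariances of the coordinate
  processes; for each \<open>i\<close> the lags \<open>j - i\<close> are distinct, so each of the \<open>n\<close> inner sums is at most
  the total absolute autocovariance.\<close>

lemma (in prob_space) nn_integral_norm_weighted_sum_le:
  fixes e :: "int \<Rightarrow> 'a \<Rightarrow> 'h::{real_inner, banach, second_countable_topology}"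
  assumes e: "\<And>i. e i \<in> borel_measurable M" and st: "strictly_stationary M e"
    and sq: "integrable M (\<lambda>\<omega>. (norm (e 1 \<omega>))\<^sup>2)"
    and centered: "integral\<^sup>L M (e 0) = 0"
    and v: "orthonormal_basis_seq v"
    and cov: "(\<lambda>(p, l). \<bar>covariance M (\<lambda>\<omega>. inner (e 0 \<omega>) (v p)) (\<lambda>\<omega>. inner (e l \<omega>) (v p))\<bar>)
                summable_on (UNIV :: (nat \<times> int) set)"
    and a: "\<And>i. i \<in> {1..n} \<Longrightarrow> \<bar>a i\<bar> \<le> A" and A: "0 \<le> A"
  shows "(\<integral>\<^sup>+\<omega>. ennreal ((norm (\<Sum>i=1..n. a i *\<^sub>R e (int i) \<omega>))\<^sup>2) \<partial>M)
    \<le> ennreal (A\<^sup>2 * real n * infsum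
        (\<lambda>(p, l). \<bar>covariance M (\<lambda>\<omega>. inner (e 0 \<omega>) (v p)) (\<lambda>\<omega>. inner (e l \<omega>) (v p))\<bar>) (UNIV :: (nat \<times> int) set))"
proof -
  let ?c = "\<lambda>(p, l::int). \<bar>covariance M (\<lambda>\<omega>. inner (e 0 \<omega>) (v p)) (\<lambda>\<omega>. inner (e l \<omega>) (v p))\<bar>"
  note [measurable] = e
  have sq_i: "integrable M (\<lambda>\<omega>. (norm (e i \<omega>))\<^sup>2)" for i
  proof -
    have f: "case_prod (\<lambda>(x::'h) (y::'h). (norm x)\<^sup>2) \<in> borel_measurable (borel \<Otimes>\<^sub>M borel)" by measurable
    have "integrable M (\<lambda>\<omega>. (norm (e 0 \<omega>))\<^sup>2)"
      using strictly_stationary_pair(2)[OF st e f, of 1] sq by simp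
    then show ?thesis using strictly_stationary_pair(2)[OF st e f, of i] by simp
  qed
  have ibl: "integrable M (\<lambda>\<omega>. inner (e i \<omega>) (v p) * inner (e j \<omega>) (v p))" for i j p
  proof (rule Bochner_Integration.integrable_bound)
    show "integrable M (\<lambda>\<omega>. (norm (e i \<omega>))\<^sup>2 + (norm (e j \<omega>))\<^sup>2)" using sq_i by simp
    have nv: "norm (v p) = 1" using v by (simp add: orthonormal_basis_seq_def norm_eq_sqrt_inner)
    have "\<bar>inner x (v p) * inner y (v p)\<bar> \<le> (norm x)\<^sup>2 + (norm y)\<^sup>2" for x y :: 'h
    proof -
      have "\<bar>inner x (v p) * inner y (v p)\<bar> \<le> norm x * norm y"
        using Cauchy_Schwarz_ineq2[of _ "v p"] unfolding abs_mult nv mult_1_right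
        by (intro mult_mono') auto
      also have "\<dots> \<le> (norm x)\<^sup>2 + (norm y)\<^sup>2"
        using sum_squares_bound[of "norm x" "norm y"] mult_nonneg_nonneg[OF norm_ge_zero[of x] norm_ge_zero[of y]]
        by linarith
      finally show ?thesis .
    qed
    then show "AE \<omega> in M. norm (inner (e i \<omega>) (v p) * inner (e j \<omega>) (v p))
        \<le> norm ((norm (e i \<omega>))\<^sup>2 + (norm (e j \<omega>))\<^sup>2)" by (intro AE_I2) auto
  qed measurable
  define c where "c p l = covariance M (\<lambda>\<omega>. inner (e 0 \<omega>) (v p)) (\<lambda>\<omega>. inner (e l \<omega>) (v p))" for p l
  have c_abs: "(\<lambda>(p, l). \<bar>c p l\<bar>) = ?c" by (auto simp: c_def)
  have "integrable M (e 0)" by (rule integrable_if_norm_sq[OF e sq_i])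
  then have "expectation (\<lambda>\<omega>. inner (e 0 \<omega>) (v p)) = 0" for p
    using centered by simp
  \<comment> \<open>The coordinates have mean zero at time 0, so the covariance reduces to the
    product moment, which stationarity moves from times \<open>i\<close>, \<open>j\<close> to lag
    \<open>j - i\<close>.\<close>
  then have c_eq: "expectation (\<lambda>\<omega>. inner (e i \<omega>) (v p) * inner (e j \<omega>) (v p)) = c p (j - i)" for p i j
    using strictly_stationary_pair(1)[OF st e, of "\<lambda>x y. inner x (v p) * inner y (v p)" i j]
    by (simp add: c_def covariance_def)
  define Y where "Y \<omega> = (\<Sum>i=1..n. a i *\<^sub>R e (int i) \<omega>)" for \<omega>
  have [measurable]: "Y \<in> borel_measurable M" unfolding Y_def by measurable
  define S where "S p = (\<Sum>i=1..n. \<Sum>j=1..n. a i * a j * c p (int j - int i))" for p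
  have Y_sq: "(inner (Y \<omega>) (v p))\<^sup>2 =
      (\<Sum>i=1..n. \<Sum>j=1..n. a i * a j * (inner (e (int i) \<omega>) (v p) * inner (e (int j) \<omega>) (v p)))" for \<omega> p
    by (simp add: Y_def inner_sum_left power2_eq_square sum_product algebra_simps)
  have S_eq: "expectation (\<lambda>\<omega>. (inner (Y \<omega>) (v p))\<^sup>2) = S p" for p
    unfolding Y_sq S_def using ibl by (simp add: Bochner_Integration.integral_sum c_eq)
  have "integrable M (\<lambda>\<omega>. (inner (Y \<omega>) (v p))\<^sup>2)" for p
    unfolding Y_sq using ibl by simp
  with S_eq have nn: "(\<integral>\<^sup>+\<omega>. ennreal ((inner (Y \<omega>) (v p))\<^sup>2) \<partial>M) = ennreal (S p)" for p
    by (simp add: nn_integral_eq_integral)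
  have S_nonneg: "0 \<le> S p" for p
    unfolding S_eq[symmetric] by (rule Bochner_Integration.integral_nonneg) simp
  have S_sum: "(\<Sum>p<P. S p) \<le> A\<^sup>2 * real n * infsum ?c (UNIV :: (nat \<times> int) set)" for P
  proof -
    have "S p \<le> (\<Sum>i=1..n. \<Sum>j=1..n. A\<^sup>2 * \<bar>c p (int j - int i)\<bar>)" for p
      unfolding S_def
    proof (intro sum_mono)
      fix i j assume "i \<in> {1..n}" "j \<in> {1..n}"
      then have "\<bar>a i * a j\<bar> \<le> A\<^sup>2"
        unfolding abs_mult power2_eq_square using a A by (intro mult_mono) auto
      then have "\<bar>a i * a j * c p (int j - int i)\<bar> \<le> A\<^sup>2 * \<bar>c p (int j - int i)\<bar>"
        by (simp add: abs_mult mult_right_mono)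
      then show "a i * a j * c p (int j - int i) \<le> A\<^sup>2 * \<bar>c p (int j - int i)\<bar>" by linarith
    qed
    then have "(\<Sum>p<P. S p) \<le> (\<Sum>p<P. \<Sum>i=1..n. \<Sum>j=1..n. A\<^sup>2 * \<bar>c p (int j - int i)\<bar>)"
      by (intro sum_mono)
    also have "\<dots> = (\<Sum>i=1..n. A\<^sup>2 * (\<Sum>p<P. \<Sum>j=1..n. \<bar>c p (int j - int i)\<bar>))"
      by (subst sum.swap) (simp add: sum_distrib_left)
    also have "\<dots> \<le> (\<Sum>i=1..n. A\<^sup>2 * infsum ?c (UNIV :: (nat \<times> int) set))"
    proof (intro sum_mono mult_left_mono)
      fix i
      have "(\<Sum>p<P. \<Sum>j=1..n. \<bar>c p (int j - int i)\<bar>) = (\<Sum>(p, l)\<in>{..<P} \<times> (\<lambda>j. int j - int i) ` {1..n}. \<bar>c p l\<bar>)"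
        by (simp add: sum.cartesian_product[symmetric] sum.reindex inj_on_def)
      also have "\<dots> \<le> infsum (\<lambda>(p, l). \<bar>c p l\<bar>) UNIV"
        using cov unfolding c_abs[symmetric] by (intro finite_sum_le_infsum) auto
      finally show "(\<Sum>p<P. \<Sum>j=1..n. \<bar>c p (int j - int i)\<bar>) \<le> infsum ?c (UNIV :: (nat \<times> int) set)" unfolding c_abs .
    qed auto
    finally show ?thesis by (simp add: mult.commute)
  qed
  \<comment> \<open>Tonelli exchanges expectation and basis expansion; the bound on partial sums,
    uniform in \<open>P\<close>, then passes to the series.\<close>
  have "(\<integral>\<^sup>+\<omega>. ennreal ((norm (Y \<omega>))\<^sup>2) \<partial>M) \<le> (\<integral>\<^sup>+\<omega>. (\<Sum>p. ennreal ((inner (Y \<omega>) (v p))\<^sup>2)) \<partial>M)"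
    by (intro nn_integral_mono norm_le_orthonormal_basis_suminf v)
  also have "\<dots> = (\<Sum>p. ennreal (S p))"
    by (subst nn_integral_suminf) (auto simp: nn)
  also have "\<dots> \<le> ennreal (A\<^sup>2 * real n * infsum ?c (UNIV :: (nat \<times> int) set))"
    using S_sum S_nonneg by (intro suminf_le_const) (auto simp: sum_ennreal ennreal_leI)
  finally show ?thesis by (simp add: Y_def)
qed

section \<open>Riemann sums\<close>

text \<open>The right-endpoint Riemann sum is the integral of a step function, since n x rounds up
  to m + 1 on the half-open cell from m / n to (m + 1) / n. This opens the way to dominated
  convergence.\<close>

lemma has_integral_ceiling_step:
  fixes F :: "nat \<Rightarrow> real"
  assumes n: "0 < n"
  shows "((\<lambda>x. F (nat \<lceil>real n * x\<rceil>)) has_integral ((\<Sum>i=1..m. F i) / real n)) {0..real m / real n}"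
proof (induction m)
  case 0
  then show ?case by (simp add: has_integral_refl)
next
  case (Suc m)
  have "((\<lambda>x. F (nat \<lceil>real n * x\<rceil>)) has_integral (F (Suc m) / real n)) {real m / real n..real (Suc m) / real n}"
  \<comment> \<open>The left endpoint belongs to the previous cell and is discarded as a null
    set.\<close>
  proof (rule has_integral_spike_finite[of "{real m / real n}"])
    have "((\<lambda>x. F (Suc m)) has_integral ((real (Suc m) / real n - real m / real n) *\<^sub>R F (Suc m)))
        {real m / real n..real (Suc m) / real n}"
      using n by (intro has_integral_const_real[where a = "real m / real n" and b = "real (Suc m) / real n",
        THEN has_integral_eq_rhs]) (simp add: divide_right_mono)
    then show "((\<lambda>x. F (Suc m)) has_integral (F (Suc m) / real n)) {real m / real n..real (Suc m) / real n}"
      by (simp add: diff_divide_distrib[symmetric])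
    fix x assume "x \<in> {real m / real n..real (Suc m) / real n} - {real m / real n}"
    then have "real m < real n * x" "real n * x \<le> real (Suc m)"
      using n by (auto simp: field_simps)
    then have "\<lceil>real n * x\<rceil> = int (Suc m)" by (intro ceiling_unique) auto
    then show "F (nat \<lceil>real n * x\<rceil>) = F (Suc m)" by (simp only: nat_int)
  qed auto
  with Suc have "((\<lambda>x. F (nat \<lceil>real n * x\<rceil>)) has_integral ((\<Sum>i=1..m. F i) / real n + F (Suc m) / real n))
      {0..real (Suc m) / real n}"
    using n by (intro has_integral_combine[where c = "real m / real n"]) (auto simp: divide_right_mono)
  then show ?case by (simp add: add_divide_distrib)
qed

lemma ceiling_grid_tendsto: "(\<lambda>n. real (nat \<lceil>real n * x\<rceil>) / real n) \<longlonglongrightarrow> x" if "0 \<le> x"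
proof (rule tendsto_sandwich)
  show "eventually (\<lambda>n. x \<le> real (nat \<lceil>real n * x\<rceil>) / real n) sequentially"
    using eventually_gt_at_top[of 0]
  proof eventually_elim
    case (elim n)
    have "real n * x \<le> real (nat \<lceil>real n * x\<rceil>)" by linarith
    then show ?case using elim by (simp add: field_simps)
  qed
  show "eventually (\<lambda>n. real (nat \<lceil>real n * x\<rceil>) / real n \<le> x + 1 / real n) sequentially"
    using eventually_gt_at_top[of 0]
  proof eventually_elim
    case (elim n)
    have "0 \<le> real n * x" using that by simp
    then have "real (nat \<lceil>real n * x\<rceil>) \<le> real n * x + 1" by linarith
    then show ?case using elim by (simp add: field_simps)
  qed
  show "(\<lambda>n. x + 1 / real n) \<longlonglongrightarrow> x"
    using tendsto_add[OF tendsto_const lim_1_over_n, of x] by simp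
qed simp

text \<open>Discontinuities can only lie on the frontiers of finitely many intervals, and frontiers
  of convex sets are negligible.\<close>

lemma piecewise_continuous_on_isCont:
  assumes "piecewise_continuous_on g a b"
  obtains N where "negligible N" "\<And>x. x \<in> {a..b} - N \<Longrightarrow> isCont g x"
proof -
  obtain \<I> where \<I>: "finite \<I>" "\<Union>\<I> = {a..b}" "\<And>I. I \<in> \<I> \<Longrightarrow> is_interval I \<and> continuous_on I g"
    using assms unfolding piecewise_continuous_on_def by blast
  have "negligible (\<Union>(frontier ` \<I>))"
    using \<I> by (intro negligible_Union) (auto simp: negligible_convex_frontier is_interval_convex)
  moreover have "isCont g x" if x: "x \<in> {a..b} - \<Union>(frontier ` \<I>)" for x
  proof -
    obtain I where I: "I \<in> \<I>" "x \<in> I" using x \<I>(2) by blast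
    then have "x \<in> interior I" using x closure_subset[of I] by (auto simp: frontier_def)
    then show ?thesis using \<I>(3)[OF I(1)] continuous_on_interior by blast
  qed
  ultimately show ?thesis using that by blast
qed

text \<open>Dominated convergence for the step functions. The integrand may depend on
  \<open>n\<close>, which accommodates a kernel whose centre moves.\<close>

lemma riemann_sum_tendsto_integral:
  fixes f :: "nat \<Rightarrow> real \<Rightarrow> real"
  assumes N: "negligible N" and bound: "\<And>n x. x \<in> {0..1} \<Longrightarrow> \<bar>f n x\<bar> \<le> B"
    and lim: "\<And>x. x \<in> {0..1} - N \<Longrightarrow> (\<lambda>n. f n (real (nat \<lceil>real n * x\<rceil>) / real n)) \<longlonglongrightarrow> F x"
  shows "(\<lambda>n. (\<Sum>i=1..n. f n (real i / real n)) / real n) \<longlonglongrightarrow> integral {0..1} F"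
proof -
  define s where "s n x = f n (real (nat \<lceil>real n * x\<rceil>) / real n)" for n x
  have hi: "(s n has_integral ((\<Sum>i=1..n. f n (real i / real n)) / real n)) {0..1}" if "0 < n" for n
    using has_integral_ceiling_step[OF that, of "\<lambda>i. f n (real i / real n)" n] that by (simp add: s_def[abs_def])
  have sp: "integral ({0..1} - N) u = integral {0..1} u" for u :: "real \<Rightarrow> real"
    using N by (intro integral_spike_set negligible_subset[OF N]) auto
  \<comment> \<open>The shift to \<open>Suc n\<close> avoids the degenerate grid at
    \<open>n = 0\<close>.\<close>
  have "(\<lambda>n. integral ({0..1} - N) (s (Suc n))) \<longlonglongrightarrow> integral ({0..1} - N) F"
  proof (rule dominated_convergence(2)[where h = "\<lambda>_. B"])
    show "s (Suc n) integrable_on ({0..1} - N)" for n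
      by (rule integrable_spike_set[OF has_integral_integrable[OF hi]]) (auto intro: negligible_subset[OF N])
    show "(\<lambda>_. B) integrable_on ({0..1} - N)"
      by (rule integrable_spike_set[OF integrable_const_ivl[of _ 0 1]]) (auto intro: negligible_subset[OF N])
    fix n x assume x: "x \<in> {0..1} - N"
    then have "real (Suc n) * x \<le> real (Suc n)" "0 \<le> real (Suc n) * x"
      by (auto intro!: mult_left_le mult_nonneg_nonneg simp del: of_nat_Suc)
    then have "nat \<lceil>real (Suc n) * x\<rceil> \<le> Suc n" by linarith
    then have "real (nat \<lceil>real (Suc n) * x\<rceil>) / real (Suc n) \<in> {0..1}"
      by (simp add: divide_le_eq_1 del: of_nat_Suc)
    then show "norm (s (Suc n) x) \<le> B" unfolding s_def real_norm_def by (rule bound)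
  next
    fix x assume "x \<in> {0..1} - N"
    then have "(\<lambda>n. s n x) \<longlonglongrightarrow> F x" unfolding s_def by (rule lim)
    then show "(\<lambda>n. s (Suc n) x) \<longlonglongrightarrow> F x" by (rule LIMSEQ_Suc)
  qed
  then have "(\<lambda>n. (\<Sum>i=1..Suc n. f (Suc n) (real i / real (Suc n))) / real (Suc n)) \<longlonglongrightarrow> integral {0..1} F"
    unfolding sp integral_unique[OF hi[OF zero_less_Suc]] .
  then show ?thesis by (rule LIMSEQ_imp_Suc)
qed

lemma holder_on_continuous_on:
  assumes "holder_on \<alpha> S f" "0 < \<alpha>"
  shows "continuous_on S f"
proof -
  obtain L where L: "\<And>x y. x \<in> S \<Longrightarrow> y \<in> S \<Longrightarrow> \<bar>f x - f y\<bar> \<le> L * \<bar>x - y\<bar> powr \<alpha>"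
    using assms by (auto simp: holder_on_def)
  show ?thesis
    unfolding continuous_on_def
  proof
    fix x assume x: "x \<in> S"
    have "((\<lambda>y. \<bar>y - x\<bar>) \<longlongrightarrow> 0) (at x within S)"
      by (rule tendsto_eq_intros refl | simp)+
    then have "((\<lambda>y. \<bar>y - x\<bar> powr \<alpha>) \<longlongrightarrow> 0) (at x within S)"
      using assms(2) by (intro tendsto_zero_powrI[where b = \<alpha>]) auto
    then have "((\<lambda>y. L * \<bar>y - x\<bar> powr \<alpha>) \<longlongrightarrow> 0) (at x within S)" by (rule tendsto_mult_right_zero)
    then have "((\<lambda>y. f y - f x) \<longlongrightarrow> 0) (at x within S)"
      by (rule Lim_null_comparison[rotated]) (auto simp: eventually_at_filter L x)
    then show "(f \<longlongrightarrow> f x) (at x within S)" by (simp add: LIM_zero_iff)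
  qed
qed

text \<open>At almost every \<open>x\<close> the grid points \<open>u n\<close> tend to
  \<open>x\<close> and the centres \<open>s n\<close> to \<open>t\<close>; continuity of
  \<open>h\<close> and of \<open>g\<close> at \<open>x\<close> gives the pointwise limit,
  boundedness the domination.\<close>

lemma kernel_riemann_sum_tendsto:
  fixes h g :: "real \<Rightarrow> real"
  assumes h: "continuous_on {-1..1} h"
    and g: "piecewise_continuous_on g 0 1" "bounded (g ` {0..1})"
    and s: "\<And>n. s n \<in> {0..1}" "s \<longlonglongrightarrow> t"
  shows "(\<lambda>n. (\<Sum>i=1..n. h (real i / real n - s n) * g (real i / real n)) / real n)
    \<longlonglongrightarrow> integral {0..1} (\<lambda>x. h (x - t) * g x)"
proof -
  have t: "t \<in> {0..1}" using s closed_sequentially[of "{0..1::real}" s t] by simp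
  obtain N where N: "negligible N" "\<And>x. x \<in> {0..1} - N \<Longrightarrow> isCont g x"
    using piecewise_continuous_on_isCont[OF g(1)] by blast
  obtain G where G: "\<forall>x\<in>{0..1}. \<bar>g x\<bar> \<le> G" using g(2) by (auto simp: bounded_iff)
  have "bounded (h ` {-1..1})" using h compact_continuous_image compact_imp_bounded by blast
  then obtain H where H: "\<forall>x\<in>{-1..1}. \<bar>h x\<bar> \<le> H" by (auto simp: bounded_iff)
  show ?thesis
  proof (rule riemann_sum_tendsto_integral[OF N(1), where B = "H * G" and f = "\<lambda>n x. h (x - s n) * g x"])
    fix n x assume x: "x \<in> {0..1::real}"
    then have "x - s n \<in> {-1..1}" using s(1)[of n] by auto
    then show "\<bar>h (x - s n) * g x\<bar> \<le> H * G"
      unfolding abs_mult using H G x by (meson mult_mono' abs_ge_zero)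
  next
    fix x assume x: "x \<in> {0..1} - N"
    define u where "u n = real (nat \<lceil>real n * x\<rceil>) / real n" for n
    have u: "u \<longlonglongrightarrow> x" unfolding u_def using x by (intro ceiling_grid_tendsto) auto
    have u01: "u n \<in> {0..1}" for n
    proof -
      have "real n * x \<le> real n" "0 \<le> real n * x" using x by (auto intro!: mult_left_le)
      then have "nat \<lceil>real n * x\<rceil> \<le> n" by linarith
      then show ?thesis by (auto simp: u_def divide_le_eq_1)
    qed
    have "u n - s n \<in> {-1..1}" for n using u01[of n] s(1)[of n] by auto
    then have "(\<lambda>n. h (u n - s n)) \<longlonglongrightarrow> h (x - t)"
      using h u s(2) x t by (intro continuous_on_tendsto_compose[OF h] tendsto_diff) auto
    moreover have "(\<lambda>n. g (u n)) \<longlonglongrightarrow> g x" using N(2)[OF x] u by (rule isCont_tendsto_compose)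
    ultimately show "(\<lambda>n. h (u n - s n) * g (u n)) \<longlonglongrightarrow> h (x - t) * g x" by (rule tendsto_mult)
  qed
qed

section \<open>The weighted CUSUM at one index\<close>

text \<open>Centring can be moved from the observations to the weights, since both forms subtract
  the same product of means.\<close>

lemma weighted_cusum_eq:
  "weighted_cusum h X n k = (1 / sqrt (real n)) *\<^sub>R
    (\<Sum>i=1..n. (h ((real i - real k) / real n) - (\<Sum>j=1..n. h ((real j - real k) / real n)) / real n) *\<^sub>R X i)"
proof -
  have "(\<Sum>i=1..n. H i *\<^sub>R (X i - (1 / real n) *\<^sub>R (\<Sum>j=1..n. X j)))
      = (\<Sum>i=1..n. (H i - (\<Sum>j=1..n. H j) / real n) *\<^sub>R X i)" for H :: "nat \<Rightarrow> real"
  proof -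
    have "(\<Sum>i=1..n. H i *\<^sub>R (X i - (1 / real n) *\<^sub>R (\<Sum>j=1..n. X j)))
      = (\<Sum>i=1..n. H i *\<^sub>R X i) - (\<Sum>i=1..n. H i) *\<^sub>R ((1 / real n) *\<^sub>R (\<Sum>j=1..n. X j))"
      by (simp only: scaleR_diff_right sum_subtractf scaleR_sum_left)
    also have "\<dots> = (\<Sum>i=1..n. H i *\<^sub>R X i) - ((\<Sum>j=1..n. H j) / real n) *\<^sub>R (\<Sum>i=1..n. X i)"
      by simp
    also have "\<dots> = (\<Sum>i=1..n. (H i - (\<Sum>j=1..n. H j) / real n) *\<^sub>R X i)"
      by (simp only: scaleR_diff_left sum_subtractf scaleR_sum_right)
    finally show ?thesis .
  qed
  then show ?thesis unfolding weighted_cusum_def by simp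
qed

text \<open>The centred weights sum to zero, so \<open>\<mu>\<close> drops out and a deterministic
  signal plus a weighted error sum remain.\<close>

lemma weighted_cusum_obs:
  fixes h :: "real \<Rightarrow> real"
  defines "a n k i \<equiv> h ((real i - real k) / real n) - (\<Sum>j=1..n. h ((real j - real k) / real n)) / real n"
  assumes n: "0 < n"
  shows "weighted_cusum h (\<lambda>i. obs \<mu> \<Delta> g e n i \<omega>) n k =
    (sqrt (real n) * ((\<Sum>i=1..n. a n k i * g (real i / real n)) / real n)) *\<^sub>R \<Delta> n
      + (1 / sqrt (real n)) *\<^sub>R (\<Sum>i=1..n. a n k i *\<^sub>R e (int i) \<omega>)"
proof -
  have "(\<Sum>i=1..n. a n k i) = 0" using n by (simp add: a_def sum_subtractf)
  moreover have "1 / sqrt (real n) = sqrt (real n) / real n"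
    using n by (simp add: field_simps)
  ultimately show ?thesis
    unfolding weighted_cusum_eq a_def[symmetric]
    by (simp add: obs_def scaleR_add_right sum.distrib scaleR_sum_left[symmetric])
qed

section \<open>Tools for convergence in probability\<close>

lemma (in prob_space) prob_Int_tendsto_1:
  assumes "\<And>n. A n \<in> events" "\<And>n. B n \<in> events"
    and "(\<lambda>n. prob (A n)) \<longlonglongrightarrow> 1" "(\<lambda>n. prob (B n)) \<longlonglongrightarrow> 1"
  shows "(\<lambda>n. prob (A n \<inter> B n)) \<longlonglongrightarrow> 1"
proof (rule tendsto_sandwich)
  show "(\<lambda>n. prob (A n) + prob (B n) - 1) \<longlonglongrightarrow> 1"
    using tendsto_diff[OF tendsto_add[OF assms(3,4)] tendsto_const[of 1]] by simp
  have "prob (A n) + prob (B n) - 1 \<le> prob (A n \<inter> B n)" for n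
  proof -
    have "prob (A n \<union> B n) = prob (A n) + prob (B n) - prob (A n \<inter> B n)"
      using assms by (intro measure_Un3) (auto simp: fmeasurable_eq_sets)
    then show ?thesis using prob_le_1[of "A n \<union> B n"] by linarith
  qed
  then show "\<forall>\<^sub>F n in sequentially. prob (A n) + prob (B n) - 1 \<le> prob (A n \<inter> B n)" by simp
qed auto

text \<open>Chebyshev's inequality: the complementary event has probability at most
  \<open>V / (r n)^2\<close> once \<open>r n\<close> is positive.\<close>

lemma (in prob_space) prob_norm_le_tendsto_1:
  fixes Z :: "nat \<Rightarrow> 'a \<Rightarrow> 'h::{real_normed_vector, second_countable_topology}"
  assumes Z[measurable]: "\<And>n. Z n \<in> borel_measurable M"
    and moment: "\<And>n. (\<integral>\<^sup>+\<omega>. ennreal ((norm (Z n \<omega>))\<^sup>2) \<partial>M) \<le> ennreal V" and V: "0 \<le> V"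
    and r: "filterlim r at_top sequentially"
  shows "(\<lambda>n. prob {\<omega>\<in>space M. norm (Z n \<omega>) \<le> r n}) \<longlonglongrightarrow> 1"
proof (rule tendsto_sandwich)
  have "filterlim (\<lambda>n. (r n)\<^sup>2) at_top sequentially"
    by (rule filterlim_pow_at_top) (use r in auto)
  then have "(\<lambda>n. V / (r n)\<^sup>2) \<longlonglongrightarrow> 0"
    by (intro tendsto_divide_0[OF tendsto_const] filterlim_at_top_imp_at_infinity)
  then show "(\<lambda>n. 1 - V / (r n)\<^sup>2) \<longlonglongrightarrow> 1"
    using tendsto_diff[OF tendsto_const[of 1]] by fastforce
  show "\<forall>\<^sub>F n in sequentially. 1 - V / (r n)\<^sup>2 \<le> prob {\<omega>\<in>space M. norm (Z n \<omega>) \<le> r n}"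
    using filterlim_at_top_dense[THEN iffD1, OF r, rule_format, of 0]
  proof eventually_elim
    case (elim n)
    have int: "integrable M (\<lambda>\<omega>. (norm (Z n \<omega>))\<^sup>2)"
      using moment[of n] by (intro integrableI_bounded) (auto simp: le_less_trans)
    have E: "expectation (\<lambda>\<omega>. (norm (Z n \<omega>))\<^sup>2) \<le> V"
      using moment[of n] V by (simp add: nn_integral_eq_integral[OF int])
    have "{\<omega>\<in>space M. \<not> norm (Z n \<omega>) \<le> r n} \<subseteq> {\<omega>\<in>space M. (r n)\<^sup>2 \<le> (norm (Z n \<omega>))\<^sup>2}"
      using elim by (auto intro!: power_mono)
    then have "prob {\<omega>\<in>space M. \<not> norm (Z n \<omega>) \<le> r n} \<le> prob {\<omega>\<in>space M. (r n)\<^sup>2 \<le> (norm (Z n \<omega>))\<^sup>2}"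
      by (intro finite_measure_mono) auto
    also have "\<dots> \<le> expectation (\<lambda>\<omega>. (norm (Z n \<omega>))\<^sup>2) / (r n)\<^sup>2"
      using elim int by (intro integral_Markov_inequality_measure[where A = "{}"]) auto
    also have "\<dots> \<le> V / (r n)\<^sup>2" using E by (rule divide_right_mono) simp
    finally show ?case using prob_neg[of "\<lambda>\<omega>. norm (Z n \<omega>) \<le> r n"] by simp
  qed
qed auto

text \<open>The definition demands the inclusion for every \<open>n\<close>. Replacing finitely many
  events by the empty set achieves this without changing the limit.\<close>

lemma tendsto_infinity_in_probI:
  assumes "\<And>K. \<exists>B. (\<forall>n. B n \<in> sets M) \<and> (\<forall>\<^sub>F n in sequentially. \<forall>\<omega>\<in>B n. \<omega> \<in> space M \<longrightarrow> K < T n \<omega>)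
    \<and> (\<lambda>n. measure M (B n)) \<longlonglongrightarrow> 1"
  shows "tendsto_infinity_in_prob M T"
  unfolding tendsto_infinity_in_prob_def
proof
  fix K
  obtain B where B: "\<And>n. B n \<in> sets M"
    "\<forall>\<^sub>F n in sequentially. \<forall>\<omega>\<in>B n. \<omega> \<in> space M \<longrightarrow> K < T n \<omega>" "(\<lambda>n. measure M (B n)) \<longlonglongrightarrow> 1"
    using assms[of K] by blast
  obtain N where N: "\<And>n \<omega>. N \<le> n \<Longrightarrow> \<omega> \<in> B n \<Longrightarrow> \<omega> \<in> space M \<and> K < T n \<omega>"
    using B(2) sets.sets_into_space[OF B(1)] unfolding eventually_sequentially by blast
  define B' where "B' n = (if N \<le> n then B n else {})" for n
  have "\<forall>n. B' n \<in> sets M \<and> B' n \<subseteq> {\<omega>\<in>space M. K < T n \<omega>}"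
    using B(1) N by (auto simp: B'_def)
  moreover have "(\<lambda>n. measure M (B' n)) \<longlonglongrightarrow> 1"
    using B(3) by (rule Lim_transform_eventually)
      (use eventually_ge_at_top[of N] in eventually_elim, simp add: B'_def)
  ultimately show "\<exists>B. (\<forall>n. B n \<in> sets M \<and> B n \<subseteq> {\<omega>\<in>space M. K < T n \<omega>}) \<and> (\<lambda>n. measure M (B n)) \<longlonglongrightarrow> 1"
    by blast
qed

lemma grid_point_tendsto:
  fixes t :: real
  defines "k n \<equiv> max 1 (nat \<lfloor>t * real n\<rfloor>)"
  assumes t: "0 \<le> t"
  shows "(\<lambda>n. real (k n) / real n) \<longlonglongrightarrow> t"
proof (rule tendsto_sandwich)
  have "t * real n - 1 \<le> real (k n) \<and> real (k n) \<le> t * real n + 1" for n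
  proof -
    have "0 \<le> t * real n" using t by simp
    then show ?thesis unfolding k_def by linarith
  qed
  note k = this
  show "\<forall>\<^sub>F n in sequentially. t - 1 / real n \<le> real (k n) / real n"
    using eventually_gt_at_top[of 0]
  proof eventually_elim
    case (elim n)
    have "(t * real n - 1) / real n \<le> real (k n) / real n" using k[of n] by (simp add: divide_right_mono)
    then show ?case using elim by (simp add: diff_divide_distrib)
  qed
  show "\<forall>\<^sub>F n in sequentially. real (k n) / real n \<le> t + 1 / real n"
    using eventually_gt_at_top[of 0]
  proof eventually_elim
    case (elim n)
    have "real (k n) / real n \<le> (t * real n + 1) / real n" using k[of n] by (simp add: divide_right_mono)
    then show ?case using elim by (simp add: add_divide_distrib)
  qed
  show "(\<lambda>n. t - 1 / real n) \<longlonglongrightarrow> t" "(\<lambda>n. t + 1 / real n) \<longlonglongrightarrow> t"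
    using tendsto_add[OF tendsto_const lim_1_over_n, of t] tendsto_diff[OF tendsto_const lim_1_over_n, of t] by simp_all
qed

text \<open>Positive semidefiniteness of \<open>A\<close> makes the shifted operator coercive with
  constant \<open>lam\<close>, so its inverse square root exists. As an eigenvalue,
  \<open>lam\<close> is at most \<open>norm A\<close>, which yields the factor 2.\<close>

lemma norm_inv_sqrt_shift_ge:
  fixes A :: "'h::{real_inner, banach} \<Rightarrow>\<^sub>L 'h"
  assumes A: "psd_op A" and lam: "largest_eigenvalue A lam" "0 < lam"
  shows "norm y \<le> sqrt (2 * norm A) * norm (inv_sqrt_op (A + lam *\<^sub>R id_blinfun) y)"
proof -
  let ?B = "A + lam *\<^sub>R id_blinfun"
  have sa: "self_adjoint_op ?B"
    using A by (auto simp: psd_op_def self_adjoint_op_def blinfun.add_left blinfun.scaleR_left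
        inner_add_left inner_add_right)
  have "lam * (norm x)\<^sup>2 \<le> inner (?B x) x" for x
    using A by (simp add: psd_op_def blinfun.add_left blinfun.scaleR_left inner_add_left power2_norm_eq_inner)
  then have S: "is_inv_sqrt ?B (inv_sqrt_op ?B)"
    using inv_sqrt_op_is_inv_sqrt[OF sa lam(2)] by blast
  obtain x where x: "x \<noteq> 0" "A x = lam *\<^sub>R x" using lam(1) by (auto simp: largest_eigenvalue_def)
  have "lam * norm x \<le> norm A * norm x" using norm_blinfun[of A x] x(2) lam(2) by simp
  then have "lam \<le> norm A" using x(1) by simp
  moreover have "norm ?B \<le> norm A + lam * norm (id_blinfun :: 'h \<Rightarrow>\<^sub>L 'h)"
    using norm_triangle_ineq[of A "lam *\<^sub>R id_blinfun"] lam(2) by simp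
  moreover have "lam * norm (id_blinfun :: 'h \<Rightarrow>\<^sub>L 'h) \<le> lam * 1"
    using lam(2) norm_blinfun_id_le by (intro mult_left_mono) auto
  ultimately have "norm ?B \<le> 2 * norm A" by linarith
  then have "sqrt (norm ?B) * norm (inv_sqrt_op ?B y) \<le> sqrt (2 * norm A) * norm (inv_sqrt_op ?B y)"
    by (intro mult_right_mono) auto
  with norm_le_norm_inv_sqrt[OF sa S, of y] show ?thesis by linarith
qed

section \<open>Divergence of the two maximum statistics\<close>

theorem theorem3p3:
  fixes M :: "'a measure"
    and \<epsilon> :: "int \<Rightarrow> 'a \<Rightarrow> 'h::{real_inner, banach, second_countable_topology}"
    and \<mu> :: 'h and \<Delta> :: "nat \<Rightarrow> 'h"
    and g h :: "real \<Rightarrow> real"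
    and C :: "int \<Rightarrow> ('h \<Rightarrow>\<^sub>L 'h)" and C\<^sub>\<epsilon> :: "'h \<Rightarrow>\<^sub>L 'h"
    and Chat :: "nat \<Rightarrow> 'a \<Rightarrow> ('h \<Rightarrow>\<^sub>L 'h)" and lamhat :: "nat \<Rightarrow> 'a \<Rightarrow> real"
  assumes M: "prob_space M"
    \<comment> \<open>conditions on g\<close>
    and g_nonconst: "\<exists>x\<in>{0..1}. \<exists>y\<in>{0..1}. g x \<noteq> g y"
    and g_bounded: "bounded (g ` {0..1})"
    and g_riemann: "riemann_integrable_on g 0 1"
    and g_pc: "piecewise_continuous_on g 0 1"
    and g0: "g 0 = 0"
    \<comment> \<open>(A1)\<close>
    and eps_meas: "\<And>i. \<epsilon> i \<in> borel_measurable M"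
    and eps_centered: "\<And>i. integral\<^sup>L M (\<epsilon> i) = 0"
    and eps_stat: "strictly_stationary M \<epsilon>"
    and eps_moment: "\<exists>k>2. integrable M (\<lambda>\<omega>. norm (\<epsilon> 1 \<omega>) powr k)"
    and C_def: "\<And>r x y. inner (C r x) y =
                   integral\<^sup>L M (\<lambda>\<omega>. inner (tensor (\<epsilon> 0 \<omega>) (\<epsilon> r \<omega>) x) y)"
    and C_summable: "(\<lambda>r. norm (C r)) summable_on UNIV"
    and C_eps_def: "(C has_sum C\<^sub>\<epsilon>) UNIV"
    and C_eps_nz: "C\<^sub>\<epsilon> \<noteq> 0"
    and eigen: "\<exists>(lam::nat \<Rightarrow> real) (v::nat \<Rightarrow> 'h). orthonormal_basis_seq v \<and> antimono lam \<and>
                  (\<forall>x. ((\<lambda>p. lam p *\<^sub>R tensor (v p) (v p) x) has_sum C\<^sub>\<epsilon> x) UNIV) \<and>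
                  (\<lambda>(p, l). \<bar>covariance M (\<lambda>\<omega>. inner (\<epsilon> 0 \<omega>) (v p)) (\<lambda>\<omega>. inner (\<epsilon> l \<omega>) (v p))\<bar>)
                     summable_on (UNIV :: (nat \<times> int) set)"
    \<comment> \<open>(A2)\<close>
    and A2: "\<exists>(N :: (real \<Rightarrow> 'h) measure) W. brownian_motion N W C\<^sub>\<epsilon> \<and>
                weak_conv_D M (partial_sum_process \<epsilon>) N W"
    \<comment> \<open>conditions on h\<close>
    and h_nonconst: "\<exists>x\<in>{-1..1}. \<exists>y\<in>{-1..1}. h x \<noteq> h y"
    and h_zero: "\<And>x. x \<in> {-1..0} \<Longrightarrow> h x = 0"
    and h_bv: "bounded_variation_on h (-1) 1"
    and h_holder: "\<exists>\<alpha>>0. holder_on \<alpha> {0..1} h"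
    and hg: "(SUP t\<in>{0..1}. \<bar>integral {0..1} (\<lambda>x. h (x - t) * g x)
                 - integral {0..1} g * integral {0..1} (\<lambda>x. h (x - t))\<bar>) > 0"
    and Delta: "filterlim (\<lambda>n. sqrt (real n) * norm (\<Delta> n)) at_top sequentially"
    \<comment> \<open>the estimator \<open>Chat\<close>\<close>
    and Chat_psd: "\<And>n \<omega>. \<omega> \<in> space M \<Longrightarrow> psd_op (Chat n \<omega>)"
    and lamhat: "\<And>n \<omega>. \<omega> \<in> space M \<Longrightarrow> largest_eigenvalue (Chat n \<omega>) (lamhat n \<omega>)"
    and lamhat_pos: "\<And>n \<omega>. \<omega> \<in> space M \<Longrightarrow> 0 < lamhat n \<omega>"
  shows "tendsto_infinity_in_prob M (\<lambda>n \<omega>. T_FF h (\<lambda>i. obs \<mu> \<Delta> g \<epsilon> n i \<omega>) n) \<and>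
         (small_o_P M (\<lambda>n \<omega>. norm (Chat n \<omega>)) (\<lambda>n. real n * (norm (\<Delta> n))\<^sup>2) \<longrightarrow>
         tendsto_infinity_in_prob M
           (\<lambda>n \<omega>. T_WF h (Chat n \<omega>) (lamhat n \<omega>) (\<lambda>i. obs \<mu> \<Delta> g \<epsilon> n i \<omega>) n))"
proof -
  interpret prob_space M by (rule M)
  note [measurable] = eps_meas
  \<comment> \<open>The Hoelder piece and the zero piece overlap at 0 and glue to a continuous
    function.\<close>
  have h_cont: "continuous_on {-1..1} h"
  proof -
    have "continuous_on {0..1} h" using h_holder holder_on_continuous_on by blast
    moreover have "continuous_on {-1..0} h"
      by (rule continuous_on_eq[of _ "\<lambda>_. 0"]) (auto simp: h_zero)
    ultimately have "continuous_on ({-1..0} \<union> {0..1}) h" by (intro continuous_on_closed_Un) auto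
    moreover have "{-1..0} \<union> {0..1} = {-1..1::real}" by auto
    ultimately show ?thesis by simp
  qed
  have "bounded (h ` {-1..1})" using h_cont compact_continuous_image compact_imp_bounded by blast
  then obtain H where H: "\<forall>x\<in>{-1..1}. \<bar>h x\<bar> \<le> H" by (auto simp: bounded_iff)
  have H0: "0 \<le> H" using H[rule_format, of 0] by simp

  define D where "D t = integral {0..1} (\<lambda>x. h (x - t) * g x)
    - integral {0..1} g * integral {0..1} (\<lambda>x. h (x - t))" for t
  have "\<exists>t\<in>{0..1}. D t \<noteq> 0"
  proof (rule ccontr)
    assume "\<not> ?thesis"
    then have "(SUP t\<in>{0..1}. \<bar>D t\<bar>) = (SUP t\<in>{0..1::real}. 0)" by (intro SUP_cong) auto
    with hg show False by (simp add: D_def)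
  qed
  then obtain t where t: "t \<in> {0..1}" "D t \<noteq> 0" by blast
  \<comment> \<open>At \<open>t = 1\<close> the kernel only sees arguments \<le> 0, where
    \<open>h\<close> vanishes, so \<open>D 1 = 0\<close>. Strictness \<open>t < 1\<close> is what
    keeps the index \<open>k n\<close> below \<open>n\<close>.\<close>
  have "t \<noteq> 1"
  proof
    assume [simp]: "t = 1"
    have "integral {0..1} (\<lambda>x. h (x - t) * g x) = integral {0..1} (\<lambda>x::real. 0)"
      by (intro Henstock_Kurzweil_Integration.integral_cong) (simp add: h_zero)
    moreover have "integral {0..1} (\<lambda>x. h (x - t)) = integral {0..1} (\<lambda>x::real. 0)"
      by (intro Henstock_Kurzweil_Integration.integral_cong) (simp add: h_zero)
    ultimately show False using t(2) by (simp add: D_def)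
  qed
  with t have t1: "0 \<le> t" "t < 1" by auto

  \<comment> \<open>The maximum with 1 keeps the index admissible when the floor is 0, in particular
    for \<open>t = 0\<close>.\<close>
  define k where "k n = max 1 (nat \<lfloor>t * real n\<rfloor>)" for n
  define s where "s n = real (k n) / real n" for n
  have k_range: "k n \<in> {1..<n}" if "2 \<le> n" for n
  proof -
    have "t * real n < real n" using t1 that by simp
    then have "nat \<lfloor>t * real n\<rfloor> < n" using that by linarith
    then show ?thesis using that by (auto simp: k_def)
  qed
  have s_lim: "s \<longlonglongrightarrow> t" using grid_point_tendsto[OF t1(1)] by (simp add: s_def[abs_def] k_def)
  \<comment> \<open>The Riemann lemma needs this for every \<open>n\<close>. Below 2 the index is 1,
    giving \<open>s 1 = 1\<close> and, by division by zero, \<open>s 0 = 0\<close>.\<close>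
  have s01: "s n \<in> {0..1}" for n
  proof (cases "2 \<le> n")
    case True
    then show ?thesis using k_range[OF True] by (auto simp: s_def divide_le_eq_1)
  next
    case False
    then have "n = 0 \<or> n = 1" by linarith
    moreover have "nat \<lfloor>t\<rfloor> = 0" using t1 by (simp add: floor_eq_iff)
    ultimately show ?thesis by (auto simp: s_def k_def)
  qed

  define a where "a n i = h ((real i - real (k n)) / real n)
    - (\<Sum>j=1..n. h ((real j - real (k n)) / real n)) / real n" for n i
  define d where "d n = (\<Sum>i=1..n. a n i * g (real i / real n)) / real n" for n
  have h_s: "h ((real i - real (k n)) / real n) = h (real i / real n - s n)" for i n
    by (simp add: s_def diff_divide_distrib)
  have "d \<longlonglongrightarrow> D t"
  proof -
    \<comment> \<open>All three limits come from the kernel lemma: with \<open>g\<close> replaced by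
      1 it gives the integral of the kernel, with \<open>h\<close> replaced by 1 that of
      \<open>g\<close>.\<close>
    have pc1: "piecewise_continuous_on (\<lambda>_. 1) 0 1"
      unfolding piecewise_continuous_on_def
    proof (intro exI[of _ "{{0..1::real}}"] conjI ballI)
      fix I assume "I \<in> {{0..1::real}}"
      then have "I = {0..1}" by simp
      then have "(0::real) < 1 \<and> {0<..<1} \<subseteq> I" by auto
      then show "\<exists>c d. c < d \<and> {c<..<d} \<subseteq> I" by blast
    qed (auto simp: is_interval_cc)
    have "(\<lambda>n. (\<Sum>i=1..n. h (real i / real n - s n) * g (real i / real n)) / real n)
        \<longlonglongrightarrow> integral {0..1} (\<lambda>x. h (x - t) * g x)"
      by (rule kernel_riemann_sum_tendsto[OF h_cont g_pc g_bounded s01 s_lim])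
    moreover have "(\<lambda>n. (\<Sum>i=1..n. h (real i / real n - s n)) / real n)
        \<longlonglongrightarrow> integral {0..1} (\<lambda>x. h (x - t))"
      using kernel_riemann_sum_tendsto[OF h_cont pc1 _ s01 s_lim] by (simp add: image_constant_conv)
    moreover have "(\<lambda>n. (\<Sum>i=1..n. g (real i / real n)) / real n) \<longlonglongrightarrow> integral {0..1} g"
      using kernel_riemann_sum_tendsto[of "\<lambda>_. 1", OF continuous_on_const g_pc g_bounded s01 s_lim] by simp
    ultimately have "(\<lambda>n. (\<Sum>i=1..n. h (real i / real n - s n) * g (real i / real n)) / real n
        - (\<Sum>i=1..n. g (real i / real n)) / real n * ((\<Sum>i=1..n. h (real i / real n - s n)) / real n))
      \<longlonglongrightarrow> D t" unfolding D_def by (intro tendsto_intros)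
    moreover have "d n = (\<Sum>i=1..n. h (real i / real n - s n) * g (real i / real n)) / real n
        - (\<Sum>i=1..n. g (real i / real n)) / real n * ((\<Sum>i=1..n. h (real i / real n - s n)) / real n)" for n
      unfolding d_def a_def h_s left_diff_distrib sum_subtractf sum_distrib_left[symmetric] diff_divide_distrib
      by (simp add: mult.commute s_def)
    ultimately show ?thesis by presburger
  qed
  then have "(\<lambda>n. \<bar>d n\<bar>) \<longlonglongrightarrow> \<bar>D t\<bar>" by (rule tendsto_rabs)
  define \<delta> where "\<delta> = \<bar>D t\<bar> / 2"
  have \<delta>: "0 < \<delta>" "\<delta> < \<bar>D t\<bar>" using t(2) by (auto simp: \<delta>_def)
  have d_ge: "\<forall>\<^sub>F n in sequentially. \<delta> < \<bar>d n\<bar>"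
    using \<open>(\<lambda>n. \<bar>d n\<bar>) \<longlonglongrightarrow> \<bar>D t\<bar>\<close> \<delta>(2) by (rule order_tendstoD)

  define r where "r n = sqrt (real n) * norm (\<Delta> n)" for n
  have r: "filterlim r at_top sequentially" using Delta by (simp add: r_def[abs_def])
  define Z where "Z n \<omega> = (1 / sqrt (real n)) *\<^sub>R (\<Sum>i=1..n. a n i *\<^sub>R \<epsilon> (int i) \<omega>)" for n \<omega>
  have Z_meas[measurable]: "Z n \<in> borel_measurable M" for n unfolding Z_def by measurable
  define Q where "Q n \<omega> = weighted_cusum h (\<lambda>i. obs \<mu> \<Delta> g \<epsilon> n i \<omega>) n (k n)" for n \<omega>
  have Q_eq: "Q n \<omega> = (sqrt (real n) * d n) *\<^sub>R \<Delta> n + Z n \<omega>" if "0 < n" for n \<omega>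
    unfolding Q_def weighted_cusum_obs[OF that] by (simp add: Z_def d_def a_def)

  obtain v where v: "orthonormal_basis_seq v" and
    cov: "(\<lambda>(p, l). \<bar>covariance M (\<lambda>\<omega>. inner (\<epsilon> 0 \<omega>) (v p)) (\<lambda>\<omega>. inner (\<epsilon> l \<omega>) (v p))\<bar>)
      summable_on (UNIV :: (nat \<times> int) set)"
    using eigen by blast
  define V where "V = infsum (\<lambda>(p, l). \<bar>covariance M (\<lambda>\<omega>. inner (\<epsilon> 0 \<omega>) (v p))
    (\<lambda>\<omega>. inner (\<epsilon> l \<omega>) (v p))\<bar>) (UNIV :: (nat \<times> int) set)"
  have V0: "0 \<le> V" unfolding V_def by (intro infsum_nonneg) auto
  \<comment> \<open>A weight and the average of all weights are each bounded by
    \<open>H\<close>.\<close>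
  have a_le: "\<bar>a n i\<bar> \<le> 2 * H" if "i \<in> {1..n}" for n i
  proof -
    have hb: "\<bar>h ((real j - real (k n)) / real n)\<bar> \<le> H" if "j \<in> {1..n}" for j
    proof -
      have "0 \<le> real j / real n" "real j / real n \<le> 1" using that by (auto simp: divide_le_eq_1)
      then have "real j / real n - s n \<in> {-1..1}" using s01[of n] unfolding atLeastAtMost_iff by linarith
      then show ?thesis unfolding h_s using H by blast
    qed
    have "\<bar>\<Sum>j=1..n. h ((real j - real (k n)) / real n)\<bar> \<le> (\<Sum>j=1..n. H)"
      by (rule order_trans[OF sum_abs]) (intro sum_mono hb)
    then have "\<bar>(\<Sum>j=1..n. h ((real j - real (k n)) / real n)) / real n\<bar> \<le> H"
      using that by (simp add: abs_divide pos_divide_le_eq mult.commute)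
    then show ?thesis using hb[OF that] unfolding a_def by linarith
  qed
  obtain p where p: "2 < p" "integrable M (\<lambda>\<omega>. norm (\<epsilon> 1 \<omega>) powr p)" using eps_moment by blast
  \<comment> \<open>The factor \<open>1 / n\<close> from the squared normalisation cancels the
    \<open>n\<close> in the second-moment bound, so the bound is uniform.\<close>
  have moment: "(\<integral>\<^sup>+\<omega>. ennreal ((norm (Z n \<omega>))\<^sup>2) \<partial>M) \<le> ennreal ((2 * H)\<^sup>2 * V)" for n
  proof (cases "n = 0")
    case True
    then show ?thesis by (simp add: Z_def)
  next
    case False
    have "(\<integral>\<^sup>+\<omega>. ennreal ((norm (Z n \<omega>))\<^sup>2) \<partial>M)
      = (\<integral>\<^sup>+\<omega>. ennreal (1 / real n) * ennreal ((norm (\<Sum>i=1..n. a n i *\<^sub>R \<epsilon> (int i) \<omega>))\<^sup>2) \<partial>M)"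
      by (intro nn_integral_cong) (simp add: Z_def power_mult_distrib power_divide ennreal_mult[symmetric])
    also have "\<dots> = ennreal (1 / real n) * (\<integral>\<^sup>+\<omega>. ennreal ((norm (\<Sum>i=1..n. a n i *\<^sub>R \<epsilon> (int i) \<omega>))\<^sup>2) \<partial>M)"
      by (intro nn_integral_cmult) measurable
    also have "\<dots> \<le> ennreal (1 / real n) * ennreal ((2 * H)\<^sup>2 * real n * V)"
      unfolding V_def
      by (intro mult_left_mono nn_integral_norm_weighted_sum_le eps_meas eps_stat
          integrable_norm_sq_if_powr[OF eps_meas p] eps_centered v cov a_le) (use H0 in auto)
    also have "\<dots> = ennreal ((2 * H)\<^sup>2 * V)"
      using False V0 by (simp add: ennreal_mult[symmetric])
    finally show ?thesis .
  qed
  \<comment> \<open>The signal has norm above \<open>\<delta> * r n\<close> eventually; allowing the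
    noise half of this leaves the other half for the statistic.\<close>
  define B where "B n = {\<omega>\<in>space M. norm (Z n \<omega>) \<le> \<delta> / 2 * r n}" for n
  have B_sets: "B n \<in> sets M" for n unfolding B_def by measurable
  have B_lim: "(\<lambda>n. prob (B n)) \<longlonglongrightarrow> 1"
    unfolding B_def
  proof (rule prob_norm_le_tendsto_1[OF Z_meas moment])
    show "0 \<le> (2 * H)\<^sup>2 * V" using V0 by simp
    show "filterlim (\<lambda>n. \<delta> / 2 * r n) at_top sequentially"
      using \<delta>(1) by (intro filterlim_tendsto_pos_mult_at_top[OF tendsto_const _ r]) simp
  qed
  have Q_ge: "\<forall>\<^sub>F n in sequentially. \<forall>\<omega>\<in>B n. \<delta> / 2 * r n \<le> norm (Q n \<omega>)"
    using d_ge eventually_gt_at_top[of 0]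
  proof eventually_elim
    case (elim n)
    show ?case
    proof
      fix \<omega> assume "\<omega> \<in> B n"
      have "\<delta> * r n \<le> \<bar>d n\<bar> * r n" using elim by (intro mult_right_mono) (auto simp: r_def)
      also have "\<dots> = norm ((sqrt (real n) * d n) *\<^sub>R \<Delta> n)" by (simp add: r_def abs_mult)
      also have "\<dots> \<le> norm (Q n \<omega>) + norm (Z n \<omega>)"
        using norm_triangle_ineq4[of "Q n \<omega>" "Z n \<omega>"] elim by (simp add: Q_eq)
      finally show "\<delta> / 2 * r n \<le> norm (Q n \<omega>)" using \<open>\<omega> \<in> B n\<close> by (simp add: B_def)
    qed
  qed
  have ge2: "\<forall>\<^sub>F n in sequentially. 2 \<le> (n::nat)" by (rule eventually_ge_at_top)
  \<comment> \<open>For \<open>2 \<le> n\<close> the index \<open>k n\<close> is among those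
    maximised over, so the maximum dominates the term at \<open>k n\<close>.\<close>
  have FF: "norm (Q n \<omega>) \<le> T_FF h (\<lambda>i. obs \<mu> \<Delta> g \<epsilon> n i \<omega>) n" if "2 \<le> n" for n \<omega>
    unfolding T_FF_def Q_def using k_range[OF that] by (intro Max_ge) auto
  have WF: "norm (inv_sqrt_op (Chat n \<omega> + lamhat n \<omega> *\<^sub>R id_blinfun) (Q n \<omega>))
      \<le> T_WF h (Chat n \<omega>) (lamhat n \<omega>) (\<lambda>i. obs \<mu> \<Delta> g \<epsilon> n i \<omega>) n" if "2 \<le> n" for n \<omega>
    unfolding T_WF_def Q_def using k_range[OF that] by (intro Max_ge) auto
  have r_gt: "\<forall>\<^sub>F n in sequentially. K < r n" for K
    using r by (simp add: filterlim_at_top_dense)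

  show ?thesis
  proof (intro conjI impI)
    show "tendsto_infinity_in_prob M (\<lambda>n \<omega>. T_FF h (\<lambda>i. obs \<mu> \<Delta> g \<epsilon> n i \<omega>) n)"
    proof (rule tendsto_infinity_in_probI, intro exI conjI allI)
      fix K
      show "\<forall>\<^sub>F n in sequentially. \<forall>\<omega>\<in>B n. \<omega> \<in> space M \<longrightarrow> K < T_FF h (\<lambda>i. obs \<mu> \<Delta> g \<epsilon> n i \<omega>) n"
        using Q_ge ge2 r_gt[of "2 * K / \<delta>"]
      proof eventually_elim
        case (elim n)
        have "K < \<delta> / 2 * r n" using elim(3) \<delta>(1) by (simp add: field_simps)
        then show ?case using elim(1) FF[OF elim(2)] by (meson less_le_trans)
      qed
    qed (use B_sets B_lim in auto)
  next
    assume small: "small_o_P M (\<lambda>n \<omega>. norm (Chat n \<omega>)) (\<lambda>n. real n * (norm (\<Delta> n))\<^sup>2)"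
    show "tendsto_infinity_in_prob M (\<lambda>n \<omega>. T_WF h (Chat n \<omega>) (lamhat n \<omega>) (\<lambda>i. obs \<mu> \<Delta> g \<epsilon> n i \<omega>) n)"
    proof (rule tendsto_infinity_in_probI)
      fix K :: real
      \<comment> \<open>\<open>L\<close> is positive and exceeds \<open>K\<close> even for negative
        \<open>K\<close>. The constant \<open>c\<close> is calibrated so that
        \<open>\<delta> / 2 * r n = c * r n * L\<close>.\<close>
      define L where "L = \<bar>K\<bar> + 1"
      have L: "0 < L" "K < L" by (auto simp: L_def)
      define c where "c = \<delta> / 2 / L"
      have c: "0 < c" using \<delta> L by (simp add: c_def)
      \<comment> \<open>The level \<open>c^2 / 2\<close> absorbs the factor 2 of the shifted
        operator: on \<open>E n\<close>, \<open>2 * norm (Chat n \<omega>)\<close> is at most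
        \<open>(c * r n)^2\<close>.\<close>
      obtain E where E: "\<And>n. E n \<in> sets M"
        "\<And>n. E n \<subseteq> {\<omega>\<in>space M. \<bar>norm (Chat n \<omega>)\<bar> \<le> c\<^sup>2 / 2 * (real n * (norm (\<Delta> n))\<^sup>2)}"
        "(\<lambda>n. prob (E n)) \<longlonglongrightarrow> 1"
        using small[unfolded small_o_P_def, rule_format, of "c\<^sup>2 / 2"] c by auto
      have "\<forall>\<^sub>F n in sequentially. \<forall>\<omega>\<in>B n \<inter> E n. \<omega> \<in> space M \<longrightarrow>
          K < T_WF h (Chat n \<omega>) (lamhat n \<omega>) (\<lambda>i. obs \<mu> \<Delta> g \<epsilon> n i \<omega>) n"
        using Q_ge ge2 r_gt[of 0]
      proof eventually_elim
        case (elim n)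
        show ?case
        proof (intro ballI impI)
          fix \<omega> assume \<omega>: "\<omega> \<in> B n \<inter> E n" "\<omega> \<in> space M"
          let ?w = "norm (inv_sqrt_op (Chat n \<omega> + lamhat n \<omega> *\<^sub>R id_blinfun) (Q n \<omega>))"
          have "2 * norm (Chat n \<omega>) \<le> (c * r n)\<^sup>2"
            using \<omega>(1) E(2)[of n] by (auto simp: r_def power_mult_distrib)
          then have "sqrt (2 * norm (Chat n \<omega>)) \<le> c * r n"
            using c elim(3) by (intro real_le_lsqrt) auto
          then have "sqrt (2 * norm (Chat n \<omega>)) * ?w \<le> c * r n * ?w" by (intro mult_right_mono) auto
          moreover have "norm (Q n \<omega>) \<le> sqrt (2 * norm (Chat n \<omega>)) * ?w"
            using \<omega>(2) by (intro norm_inv_sqrt_shift_ge Chat_psd lamhat lamhat_pos)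
          ultimately have "\<delta> / 2 * r n \<le> c * r n * ?w" using elim(1) \<omega>(1) by fastforce
          then have "c * r n * L \<le> c * r n * ?w" using L by (simp add: c_def)
          then have "L \<le> ?w" using c elim(3) by simp
          then show "K < T_WF h (Chat n \<omega>) (lamhat n \<omega>) (\<lambda>i. obs \<mu> \<Delta> g \<epsilon> n i \<omega>) n"
            using WF[OF elim(2), of \<omega>] L(2) by linarith
        qed
      qed
      moreover have "(\<lambda>n. prob (B n \<inter> E n)) \<longlonglongrightarrow> 1"
        by (rule prob_Int_tendsto_1[OF B_sets E(1) B_lim E(3)])
      ultimately show "\<exists>B. (\<forall>n. B n \<in> sets M) \<and> (\<forall>\<^sub>F n in sequentially. \<forall>\<omega>\<in>B n. \<omega> \<in> space M \<longrightarrow>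
          K < T_WF h (Chat n \<omega>) (lamhat n \<omega>) (\<lambda>i. obs \<mu> \<Delta> g \<epsilon> n i \<omega>) n) \<and> (\<lambda>n. prob (B n)) \<longlonglongrightarrow> 1"
        using B_sets E(1) by (intro exI[of _ "\<lambda>n. B n \<inter> E n"]) auto
    qed
  qed
qed

end
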